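(* Let $m\geq2$ and $d\geq1$ be integers. Then the standard locus $U^{(m,d)}_{st}$ is a smooth subset of $\mathbb{P}(R_d)$.
   Context: $\mathbb{K}$ is an algebraically closed field of characteristic $0$; $R=\mathbb{K}[x_1,\dots,x_m]$ with the standard grading; $Q=\mathbb{K}[X_1,\dots,X_m]$, with $X_i=\partial/\partial x_i$, acts on $R$ by differentiation. The standard locus of socle degree $d$ and codimension $m$ is $$U^{(m,d)}_{st}=\{[f]\in\mathbb{P}(R_d)\mid \lambda(f)\neq0\ \text{for all nonzero}\ \lambda\in Q_1\},$$ with the Zariski topology. *)

theory Defs
  imports
    "HOL-Analysis.Abstract_Topology"
    "HOL-Computational_Algebra.Polynomial"
    "HOL-Library.Poly_Mapping"
    "HOL-Library.Extended_Nat"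
begin

section \<open>Polynomials in several variables\<close>

text \<open>A monomial is a finitely supported exponent function, a polynomial is a finitely supported
  function from monomials to coefficients; sum and product are those of Poly-Mapping.\<close>

type_synonym ('v, 'a) mpoly = "('v \<Rightarrow>\<^sub>0 nat) \<Rightarrow>\<^sub>0 'a"

abbreviation keys :: "('k \<Rightarrow>\<^sub>0 'b::zero) \<Rightarrow> 'k set" where
  "keys \<equiv> Poly_Mapping.keys"

abbreviation lookup :: "('k \<Rightarrow>\<^sub>0 'b::zero) \<Rightarrow> 'k \<Rightarrow> 'b" where
  "lookup \<equiv> Poly_Mapping.lookup"

definition total_degree :: "('v \<Rightarrow>\<^sub>0 nat) \<Rightarrow> nat" where
  "total_degree \<mu> = (\<Sum>i\<in>keys \<mu>. lookup \<mu> i)"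

definition homogeneous :: "nat \<Rightarrow> ('v, 'a::zero) mpoly \<Rightarrow> bool" where
  "homogeneous d F \<longleftrightarrow> (\<forall>\<mu>\<in>keys F. total_degree \<mu> = d)"

definition eval_monomial :: "('v \<Rightarrow> 'a::comm_semiring_1) \<Rightarrow> ('v \<Rightarrow>\<^sub>0 nat) \<Rightarrow> 'a" where
  "eval_monomial x \<mu> = (\<Prod>i\<in>keys \<mu>. x i ^ lookup \<mu> i)"

definition eval_mpoly :: "('v \<Rightarrow> 'a::comm_semiring_1) \<Rightarrow> ('v, 'a) mpoly \<Rightarrow> 'a" where
  "eval_mpoly x F = (\<Sum>\<mu>\<in>keys F. lookup F \<mu> * eval_monomial x \<mu>)"

text \<open>If the variable \<open>i\<close> does not occur in \<open>\<mu>\<close>, subtraction of exponents is truncated, but then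
  the coefficient is zero.\<close>

definition partial :: "'v \<Rightarrow> ('v, 'a::comm_semiring_1) mpoly \<Rightarrow> ('v, 'a) mpoly" where
  "partial i F = (\<Sum>\<mu>\<in>keys F.
     Poly_Mapping.single (\<mu> - Poly_Mapping.single i 1) (of_nat (lookup \<mu> i) * lookup F \<mu>))"

definition scale :: "'a \<Rightarrow> ('v \<Rightarrow>\<^sub>0 'a) \<Rightarrow> ('v \<Rightarrow>\<^sub>0 'a::comm_semiring_1)" where
  "scale c f = Poly_Mapping.map ((*) c) f"


section \<open>The Zariski topology of a projective space\<close>

text \<open>Let \<open>V\<close> be a finite-dimensional linear subspace of the space \<open>'v \<Rightarrow>\<^sub>0 'a\<close> of finitely supported
  coordinate vectors (below, \<open>V\<close> consists of all vectors supported in a fixed finite set). A point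
  of the projective space of \<open>V\<close> is the set of nonzero multiples of a nonzero vector of \<open>V\<close>.
  Homogeneous coordinates are the coordinates of the vectors, and homogeneous polynomials in them
  have type \<open>('v, 'a) mpoly\<close>.\<close>

definition proj_point :: "('v \<Rightarrow>\<^sub>0 'a::field) \<Rightarrow> ('v \<Rightarrow>\<^sub>0 'a) set" where
  "proj_point f = {scale c f |c. c \<noteq> 0}"

definition proj_space :: "('v \<Rightarrow>\<^sub>0 'a::field) set \<Rightarrow> ('v \<Rightarrow>\<^sub>0 'a) set set" where
  "proj_space V = proj_point ` (V - {0})"

definition vanishes_at :: "('v, 'a::field) mpoly \<Rightarrow> ('v \<Rightarrow>\<^sub>0 'a) set \<Rightarrow> bool" where
  "vanishes_at F p \<longleftrightarrow> (\<forall>f\<in>p. eval_mpoly (lookup f) F = 0)"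

definition zero_locus :: "('v \<Rightarrow>\<^sub>0 'a::field) set \<Rightarrow> ('v, 'a) mpoly set \<Rightarrow> ('v \<Rightarrow>\<^sub>0 'a) set set" where
  "zero_locus V S = {p \<in> proj_space V. \<forall>F\<in>S. vanishes_at F p}"

definition zariski :: "('v \<Rightarrow>\<^sub>0 'a::field) set \<Rightarrow> ('v \<Rightarrow>\<^sub>0 'a) set topology" where
  "zariski V = topology (\<lambda>U. \<exists>S. (\<forall>F\<in>S. \<exists>k. homogeneous k F) \<and> U = proj_space V - zero_locus V S)"


section \<open>Dimension\<close>

definition irreducible_subset :: "'p topology \<Rightarrow> 'p set \<Rightarrow> bool" where
  "irreducible_subset T Z \<longleftrightarrow> Z \<noteq> {} \<and> Z \<subseteq> topspace T \<and>
     (\<forall>A B. closedin T A \<and> closedin T B \<and> Z \<subseteq> A \<union> B \<longrightarrow> Z \<subseteq> A \<or> Z \<subseteq> B)"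

definition krull_dim :: "'p topology \<Rightarrow> enat" where
  "krull_dim T = Sup {enat n |n. \<exists>Z :: nat \<Rightarrow> 'p set.
     (\<forall>i\<le>n. closedin T (Z i) \<and> irreducible_subset T (Z i)) \<and> (\<forall>i<n. Z i \<subset> Z (Suc i))}"

definition local_dim :: "'p topology \<Rightarrow> 'p \<Rightarrow> enat" where
  "local_dim T p = Inf {krull_dim (subtopology T U) |U. openin T U \<and> p \<in> U}"


section \<open>Smooth subsets of a projective space\<close>

text \<open>The linear subspace of \<open>V\<close> whose projectivization is the projective tangent space of \<open>X\<close> at
  the point represented by \<open>f\<close>; \<open>X\<close> carries its reduced structure. By Euler's formula the subspace
  contains \<open>f\<close>, and its quotient by the line through \<open>f\<close> is the Zariski tangent space of \<open>X\<close>.\<close>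

definition proj_tangent_space ::
  "('v \<Rightarrow>\<^sub>0 'a::field) set \<Rightarrow> ('v \<Rightarrow>\<^sub>0 'a) set set \<Rightarrow> ('v \<Rightarrow>\<^sub>0 'a) \<Rightarrow> ('v \<Rightarrow>\<^sub>0 'a) set" where
  "proj_tangent_space V X f = {v \<in> V. \<forall>F. (\<exists>k. homogeneous k F) \<and> (\<forall>p\<in>X. vanishes_at F p) \<longrightarrow>
     (\<Sum>i\<in>keys v. eval_mpoly (lookup f) (partial i F) * lookup v i) = 0}"

text \<open>A point is smooth if the dimension of the Zariski tangent space, which is one less than that
  of the linear space above, is the local dimension of \<open>X\<close>.\<close>

definition smooth_at :: "('v \<Rightarrow>\<^sub>0 'a::field) set \<Rightarrow> ('v \<Rightarrow>\<^sub>0 'a) set set \<Rightarrow> ('v \<Rightarrow>\<^sub>0 'a) \<Rightarrow> bool" where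
  "smooth_at V X f \<longleftrightarrow>
     enat (vector_space.dim scale (proj_tangent_space V X f))
       = local_dim (subtopology (zariski V) X) (proj_point f) + 1"

definition smooth_subset :: "('v \<Rightarrow>\<^sub>0 'a::field) set \<Rightarrow> ('v \<Rightarrow>\<^sub>0 'a) set set \<Rightarrow> bool" where
  "smooth_subset V X \<longleftrightarrow>
     (\<exists>U C. openin (zariski V) U \<and> closedin (zariski V) C \<and> X = U \<inter> C) \<and>
     (\<forall>f \<in> V - {0}. proj_point f \<in> X \<longrightarrow> smooth_at V X f)"


section \<open>The standard locus\<close>

text \<open>The degree \<open>d\<close> part of the polynomial ring in \<open>m\<close> variables, indexed by \<open>0, \<dots>, m - 1\<close>.
  It serves both for \<open>R\<close> and for the ring \<open>Q\<close> of differential operators.\<close>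

definition graded_part :: "nat \<Rightarrow> nat \<Rightarrow> (nat, 'a::zero) mpoly set" where
  "graded_part m d = {f. homogeneous d f \<and> (\<forall>\<mu>\<in>keys f. keys \<mu> \<subseteq> {..<m})}"

definition partial_monomial :: "(nat \<Rightarrow>\<^sub>0 nat) \<Rightarrow> (nat, 'a::comm_semiring_1) mpoly \<Rightarrow> (nat, 'a) mpoly" where
  "partial_monomial \<mu> f = fold (\<lambda>i. partial i ^^ lookup \<mu> i) (sorted_list_of_set (keys \<mu>)) f"

definition diff_action ::
  "(nat, 'a::comm_semiring_1) mpoly \<Rightarrow> (nat, 'a) mpoly \<Rightarrow> (nat, 'a) mpoly" where
  "diff_action q f = (\<Sum>\<mu>\<in>keys q. scale (lookup q \<mu>) (partial_monomial \<mu> f))"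

definition standard_locus :: "nat \<Rightarrow> nat \<Rightarrow> (nat, 'a::field) mpoly set set" where
  "standard_locus m d = proj_point `
     {f \<in> graded_part m d - {0}. \<forall>q \<in> graded_part m 1 - {0}. diff_action q f \<noteq> 0}"


section \<open>The Zariski topology is a topology\<close>

lemma eval_monomial_superset:
  assumes "finite A" "keys \<mu> \<subseteq> A"
  shows "eval_monomial x \<mu> = (\<Prod>i\<in>A. x i ^ lookup \<mu> i)"
  unfolding eval_monomial_def using assms
  by (intro prod.mono_neutral_left) (auto simp: in_keys_iff)

lemma eval_monomial_add: "eval_monomial x (\<mu> + \<nu>) = eval_monomial x \<mu> * eval_monomial x \<nu>"
proof -
  let ?A = "keys \<mu> \<union> keys \<nu>"
  have "keys (\<mu> + \<nu>) \<subseteq> ?A" by (rule Poly_Mapping.keys_add)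
  then show ?thesis
    by (simp add: eval_monomial_superset[of ?A] lookup_add power_add prod.distrib)
qed

lemma eval_mpoly_superset:
  assumes "finite A" "keys F \<subseteq> A"
  shows "eval_mpoly x F = (\<Sum>\<mu>\<in>A. lookup F \<mu> * eval_monomial x \<mu>)"
  unfolding eval_mpoly_def using assms
  by (intro sum.mono_neutral_left) (auto simp: in_keys_iff)

lemma eval_mpoly_add: "eval_mpoly x (F + G) = eval_mpoly x F + eval_mpoly x G"
proof -
  let ?A = "keys F \<union> keys G"
  have "keys (F + G) \<subseteq> ?A" by (rule Poly_Mapping.keys_add)
  then show ?thesis
    by (simp add: eval_mpoly_superset[of ?A] lookup_add sum.distrib distrib_right)
qed

lemma eval_mpoly_zero [simp]: "eval_mpoly x 0 = 0"
  by (simp add: eval_mpoly_def)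

lemma eval_mpoly_one [simp]: "eval_mpoly x 1 = 1"
  by (simp add: eval_mpoly_def eval_monomial_def)

lemma eval_mpoly_sum: "eval_mpoly x (\<Sum>a\<in>A. F a) = (\<Sum>a\<in>A. eval_mpoly x (F a))"
  by (induction A rule: infinite_finite_induct) (auto simp: eval_mpoly_add)

lemma eval_mpoly_single: "eval_mpoly x (Poly_Mapping.single \<mu> c) = c * eval_monomial x \<mu>"
  by (simp add: eval_mpoly_def)

lemma mpoly_sum_monomials: "F = (\<Sum>\<mu>\<in>keys F. Poly_Mapping.single \<mu> (lookup F \<mu>))"
  by (rule poly_mapping_eqI)
    (simp add: lookup_sum lookup_single when_def sum.delta in_keys_iff)

lemma eval_mpoly_mult: "eval_mpoly x (F * G) = eval_mpoly x F * eval_mpoly x G"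
proof -
  have "F * G = (\<Sum>\<mu>\<in>keys F. \<Sum>\<nu>\<in>keys G. Poly_Mapping.single (\<mu> + \<nu>) (lookup F \<mu> * lookup G \<nu>))"
    by (subst mpoly_sum_monomials[of F], subst mpoly_sum_monomials[of G])
      (simp add: sum_product mult_single)
  then have "eval_mpoly x (F * G) = (\<Sum>\<mu>\<in>keys F. \<Sum>\<nu>\<in>keys G.
      (lookup F \<mu> * eval_monomial x \<mu>) * (lookup G \<nu> * eval_monomial x \<nu>))"
    by (simp add: eval_mpoly_sum eval_mpoly_single eval_monomial_add mult_ac)
  then show ?thesis
    by (simp add: eval_mpoly_def sum_product)
qed

lemma total_degree_superset:
  assumes "finite A" "keys \<mu> \<subseteq> A"
  shows "total_degree \<mu> = (\<Sum>i\<in>A. lookup \<mu> i)"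
  unfolding total_degree_def using assms
  by (intro sum.mono_neutral_left) (auto simp: in_keys_iff)

lemma total_degree_add: "total_degree (\<mu> + \<nu>) = total_degree \<mu> + total_degree \<nu>"
proof -
  let ?A = "keys \<mu> \<union> keys \<nu>"
  have "keys (\<mu> + \<nu>) \<subseteq> ?A" by (rule Poly_Mapping.keys_add)
  then show ?thesis
    by (simp add: total_degree_superset[of ?A] lookup_add sum.distrib)
qed

lemma homogeneous_mult:
  assumes "homogeneous k F" "homogeneous l G"
  shows "homogeneous (k + l) (F * G)"
  using assms keys_mult[of F G] by (fastforce simp: homogeneous_def total_degree_add)

lemma lookup_scale: "lookup (scale c f) i = c * lookup f i"
  by (simp add: scale_def Poly_Mapping.map.rep_eq when_def)

lemma eval_mpoly_scale:
  assumes "homogeneous k F"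
  shows "eval_mpoly (lookup (scale c f)) F = c ^ k * eval_mpoly (lookup f) F"
proof -
  have "eval_monomial (lookup (scale c f)) \<mu> = c ^ total_degree \<mu> * eval_monomial (lookup f) \<mu>" for \<mu>
    by (simp add: eval_monomial_def total_degree_def lookup_scale power_mult_distrib prod.distrib
        power_sum)
  then show ?thesis
    using assms by (simp add: eval_mpoly_def homogeneous_def sum_distrib_left mult_ac)
qed

lemma vanishes_at_proj_point:
  assumes "homogeneous k F"
  shows "vanishes_at F (proj_point f) \<longleftrightarrow> eval_mpoly (lookup f) F = 0"
proof -
  have "scale 1 f = f"
    by (rule poly_mapping_eqI) (simp add: lookup_scale)
  then have "f \<in> proj_point f"
    unfolding proj_point_def by (metis (mono_tags, lifting) mem_Collect_eq one_neq_zero)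
  then show ?thesis
    using eval_mpoly_scale[OF assms] by (auto simp: vanishes_at_def proj_point_def)
qed

lemma vanishes_at_mult:
  assumes "homogeneous k F" "homogeneous l G" "p \<in> proj_space V"
  shows "vanishes_at (F * G) p \<longleftrightarrow> vanishes_at F p \<or> vanishes_at G p"
  using assms(3) vanishes_at_proj_point[OF assms(1)] vanishes_at_proj_point[OF assms(2)]
    vanishes_at_proj_point[OF homogeneous_mult[OF assms(1,2)]]
  by (auto simp: proj_space_def eval_mpoly_mult)

lemma zero_locus_Un:
  assumes "\<forall>F\<in>S. \<exists>k. homogeneous k F" "\<forall>G\<in>T. \<exists>k. homogeneous k G"
  shows "zero_locus V S \<union> zero_locus V T = zero_locus V {F * G |F G. F \<in> S \<and> G \<in> T}"
    (is "?L = ?R")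
proof
  show "?L \<subseteq> ?R"
    using assms by (fastforce simp: zero_locus_def vanishes_at_mult)
  show "?R \<subseteq> ?L"
  proof
    fix p assume p: "p \<in> ?R"
    then have V: "p \<in> proj_space V" by (simp add: zero_locus_def)
    show "p \<in> ?L"
    proof (rule ccontr)
      assume "p \<notin> ?L"
      then obtain F G where FG: "F \<in> S" "G \<in> T" "\<not> vanishes_at F p" "\<not> vanishes_at G p"
        using V by (auto simp: zero_locus_def)
      then have "\<not> vanishes_at (F * G) p"
        using assms vanishes_at_mult V by blast
      with p FG show False by (auto simp: zero_locus_def)
    qed
  qed
qed

lemma openin_zariski:
  "openin (zariski V) U \<longleftrightarrow>
     (\<exists>S. (\<forall>F\<in>S. \<exists>k. homogeneous k F) \<and> U = proj_space V - zero_locus V S)"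
proof -
  let ?P = "\<lambda>U. \<exists>S. (\<forall>F\<in>S. \<exists>k. homogeneous k F) \<and> U = proj_space V - zero_locus V S"
  have "istopology ?P"
    unfolding istopology_def
  proof (intro conjI allI impI)
    fix U U' assume "?P U" "?P U'"
    then obtain S T where S: "\<forall>F\<in>S. \<exists>k. homogeneous k F" "U = proj_space V - zero_locus V S"
      and T: "\<forall>F\<in>T. \<exists>k. homogeneous k F" "U' = proj_space V - zero_locus V T" by blast
    have "\<forall>H\<in>{F * G |F G. F \<in> S \<and> G \<in> T}. \<exists>k. homogeneous k H"
      using S T homogeneous_mult by blast
    moreover have "U \<inter> U' = proj_space V - zero_locus V {F * G |F G. F \<in> S \<and> G \<in> T}"
      unfolding S T zero_locus_Un[OF S(1) T(1), symmetric] by blast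
    ultimately show "?P (U \<inter> U')" by blast
  next
    fix \<U> assume "\<forall>U\<in>\<U>. ?P U"
    then obtain S where S: "\<And>U. U \<in> \<U> \<Longrightarrow> (\<forall>F\<in>S U. \<exists>k. homogeneous k F)"
      "\<And>U. U \<in> \<U> \<Longrightarrow> U = proj_space V - zero_locus V (S U)" by metis
    have "\<Union>\<U> = proj_space V - zero_locus V (\<Union>U\<in>\<U>. S U)"
      using S(2) unfolding zero_locus_def by blast
    with S(1) show "?P (\<Union>\<U>)" by (intro exI[of _ "\<Union>U\<in>\<U>. S U"]) blast
  qed
  then show ?thesis by (simp add: zariski_def topology_inverse')
qed

lemma topspace_zariski [simp]: "topspace (zariski V) = proj_space V"
proof
  show "topspace (zariski V) \<subseteq> proj_space V"
    using openin_zariski[of V "topspace (zariski V)"] by auto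
  have "homogeneous 0 1" "proj_space V = proj_space V - zero_locus V {1}"
    by (auto simp: homogeneous_def total_degree_def zero_locus_def vanishes_at_proj_point[of 0]
        proj_space_def)
  then have "openin (zariski V) (proj_space V)"
    unfolding openin_zariski by (intro exI[of _ "{1}"]) auto
  then show "proj_space V \<subseteq> topspace (zariski V)" by (rule openin_subset)
qed

lemma closedin_zariski:
  "closedin (zariski V) C \<longleftrightarrow> (\<exists>S. (\<forall>F\<in>S. \<exists>k. homogeneous k F) \<and> C = zero_locus V S)"
proof -
  have "zero_locus V S \<subseteq> proj_space V" for S by (auto simp: zero_locus_def)
  then show ?thesis
    unfolding closedin_def openin_zariski topspace_zariski
    by (metis Diff_Diff_Int inf.absorb_iff2)
qed

lemma vector_space_scale: "vector_space (scale :: 'a::field \<Rightarrow> ('v \<Rightarrow>\<^sub>0 'a) \<Rightarrow> _)"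
  by unfold_locales
    (auto intro!: poly_mapping_eqI simp: lookup_scale lookup_add algebra_simps)

end

theory Submission
  imports Defs
begin

text \<open>The standard locus is open in the projective space of forms of degree \<open>d\<close>, and every open
  subset of a projective space is smooth.

  A form \<open>f\<close> is standard iff its \<open>m\<close> partial derivatives are linearly independent. The coefficients
  of the derivatives are linear in those of \<open>f\<close>, so independence at \<open>f\<close> is witnessed by a
  form in the coefficients, such as a maximal minor of their matrix, that is nonzero at \<open>f\<close> and forces
  independence wherever it is nonzero (\<open>independence_witness\<close>). This makes the locus open.

  Now let \<open>X\<close> be open in the projective space on a set \<open>A\<close> of coordinates, and let \<open>f\<close> represent a
  point of \<open>X\<close>. The field is infinite, so a form vanishing on \<open>X\<close> vanishes on every line through \<open>f\<close>
  and has zero derivatives at \<open>f\<close>. Hence the tangent space is the whole space, of dimension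
  \<open>card A\<close> (\<open>proj_tangent_space_open\<close>). It remains to see that every nonempty open subset \<open>W\<close> has
  Krull dimension \<open>card A - 1\<close>.

  For the lower bound, intersect \<open>W\<close> with a complete flag of linear subspaces through one of its
  points (\<open>krull_dim_open_ge\<close>); the intersections are irreducible, again by restricting forms to lines.

  For the upper bound, take a chain \<open>Z 0 \<subset> \<dots> \<subset> Z n\<close> of irreducible closed subsets and forms
  \<open>F 0, \<dots>, F n\<close> of a common degree such that \<open>F i\<close> vanishes on \<open>Z (i - 1)\<close> but not on \<open>Z i\<close>. They are
  algebraically independent (\<open>algebraically_independent_on_chain\<close>). But the products of degree \<open>s\<close>
  in \<open>n + 1\<close> forms number about \<open>s ^ n\<close>, while the forms of the resulting degree in \<open>card A\<close> variables
  make up a space of dimension of order \<open>s ^ (card A - 1)\<close>. Hence \<open>n + 1 \<le> card A\<close>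
  (\<open>card_algebraically_independent_le\<close>, \<open>krull_dim_subtopology_le\<close>).\<close>

section \<open>Forms in a set of variables\<close>

definition monomials :: "'v set \<Rightarrow> nat \<Rightarrow> ('v \<Rightarrow>\<^sub>0 nat) set" where
  "monomials A k = {\<mu>. keys \<mu> \<subseteq> A \<and> total_degree \<mu> = k}"

lemma homogeneous_iff_monomials: "homogeneous k F \<longleftrightarrow> keys F \<subseteq> monomials UNIV k"
  by (auto simp: homogeneous_def monomials_def)

lemma homogeneous_if_monomials: "keys F \<subseteq> monomials A k \<Longrightarrow> homogeneous k F"
  by (auto simp: homogeneous_def monomials_def)

lemma add_in_monomials:
  assumes "\<mu> \<in> monomials A k" "\<nu> \<in> monomials A l"
  shows "\<mu> + \<nu> \<in> monomials A (k + l)"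
  using assms Poly_Mapping.keys_add[of \<mu> \<nu>] by (auto simp: monomials_def total_degree_add)

lemma monomials_degree_0: "monomials A 0 = {0}"
proof -
  have "\<mu> = 0" if "total_degree \<mu> = 0" for \<mu> :: "'a \<Rightarrow>\<^sub>0 nat"
    using that by (intro poly_mapping_eqI) (auto simp: total_degree_def in_keys_iff)
  then show ?thesis by (auto simp: monomials_def total_degree_def)
qed

lemma single_in_monomials: "i \<in> A \<Longrightarrow> Poly_Mapping.single i k \<in> monomials A k"
  by (auto simp: monomials_def total_degree_def)

lemma keys_mult_monomials:
  assumes "keys F \<subseteq> monomials A k" "keys G \<subseteq> monomials A l"
  shows "keys (F * G) \<subseteq> monomials A (k + l)"
  using assms keys_mult[of F G] add_in_monomials by fast

lemma keys_one_monomials: "keys (1 :: ('v, 'a::comm_semiring_1) mpoly) \<subseteq> monomials A 0"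
  by (simp add: monomials_degree_0)

lemma keys_power_monomials:
  fixes F :: "('v, 'a::comm_semiring_1) mpoly"
  assumes "keys F \<subseteq> monomials A k"
  shows "keys (F ^ n) \<subseteq> monomials A (n * k)"
proof (induction n)
  case 0
  show ?case using keys_one_monomials by simp
next
  case (Suc n)
  show ?case using keys_mult_monomials[OF assms Suc.IH] by (simp add: add.commute)
qed

lemma keys_prod_monomials:
  fixes F :: "'i \<Rightarrow> ('v, 'a::comm_semiring_1) mpoly"
  assumes "\<And>i. i \<in> I \<Longrightarrow> keys (F i) \<subseteq> monomials A (k i)"
  shows "keys (\<Prod>i\<in>I. F i) \<subseteq> monomials A (\<Sum>i\<in>I. k i)"
  using assms
proof (induction I rule: infinite_finite_induct)
  case (insert i I)
  then show ?case using keys_mult_monomials[of "F i" A "k i" "\<Prod>i\<in>I. F i"] by simp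
qed (use keys_one_monomials in auto)

lemma keys_eval_monomial:
  fixes F :: "'i \<Rightarrow> ('v, 'a::comm_semiring_1) mpoly"
  assumes F: "\<And>i. i \<in> B \<Longrightarrow> keys (F i) \<subseteq> monomials A e" and \<mu>: "\<mu> \<in> monomials B k"
  shows "keys (eval_monomial F \<mu>) \<subseteq> monomials A (k * e)"
proof -
  have "keys (eval_monomial F \<mu>) \<subseteq> monomials A (\<Sum>i\<in>keys \<mu>. lookup \<mu> i * e)"
    unfolding eval_monomial_def
  proof (intro keys_prod_monomials keys_power_monomials F)
    show "i \<in> B" if "i \<in> keys \<mu>" for i using \<mu> that by (auto simp: monomials_def)
  qed
  also have "(\<Sum>i\<in>keys \<mu>. lookup \<mu> i * e) = k * e"
    using \<mu> by (simp add: monomials_def total_degree_def flip: sum_distrib_right)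
  finally show ?thesis .
qed

lemma keys_scale_subset: "keys (scale c F) \<subseteq> keys F"
  by (auto simp: in_keys_iff lookup_scale)

lemma keys_sum_monomials:
  assumes "\<And>i. i \<in> I \<Longrightarrow> keys (F i) \<subseteq> monomials A k"
  shows "keys (\<Sum>i\<in>I. F i) \<subseteq> monomials A k"
  using assms
proof (induction I rule: infinite_finite_induct)
  case (insert i I)
  then show ?case using Poly_Mapping.keys_add[of "F i" "\<Sum>i\<in>I. F i"] by auto
qed auto

lemma homogeneous_diff:
  fixes F G :: "('v, 'a::ab_group_add) mpoly"
  shows "homogeneous k F \<Longrightarrow> homogeneous k G \<Longrightarrow> homogeneous k (F - G)"
  using keys_diff[of F G] by (auto simp: homogeneous_def)

lemma eval_mpoly_diff:
  fixes F G :: "('v, 'a::comm_ring_1) mpoly"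
  shows "eval_mpoly x (F - G) = eval_mpoly x F - eval_mpoly x G"
  using eval_mpoly_add[of x "F - G" G] by simp

lemma eval_mpoly_scale_coeffs: "eval_mpoly x (scale c F) = c * eval_mpoly x F"
  using eval_mpoly_superset[OF finite_keys keys_scale_subset, of x c F]
  by (simp add: lookup_scale eval_mpoly_def sum_distrib_left mult_ac)

lemma eval_mpoly_power: "eval_mpoly x (F ^ n) = eval_mpoly x F ^ n"
  by (induction n) (auto simp: eval_mpoly_mult)

lemma eval_mpoly_prod: "eval_mpoly x (\<Prod>i\<in>I. F i) = (\<Prod>i\<in>I. eval_mpoly x (F i))"
  by (induction I rule: infinite_finite_induct) (auto simp: eval_mpoly_mult)

lemma eval_mpoly_eval_monomial:
  "eval_mpoly x (eval_monomial F \<mu>) = eval_monomial (\<lambda>i. eval_mpoly x (F i)) \<mu>"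
  by (simp add: eval_monomial_def eval_mpoly_prod eval_mpoly_power)

lemma eval_monomial_0 [simp]: "eval_monomial x 0 = 1"
  by (simp add: eval_monomial_def)

lemma eval_monomial_single [simp]: "eval_monomial x (Poly_Mapping.single i k) = x i ^ k"
  by (simp add: eval_monomial_def)

lemma eval_mpoly_variable:
  "eval_mpoly x (Poly_Mapping.single (Poly_Mapping.single i 1) c) = c * x i"
  by (simp add: eval_mpoly_single)

lemma homogeneous_variable:
  "homogeneous 1 (Poly_Mapping.single (Poly_Mapping.single i 1) c)"
  by (auto simp: homogeneous_def total_degree_def)

lemma eval_monomial_eq_0:
  assumes "i \<in> keys \<mu>" "x i = 0"
  shows "eval_monomial x \<mu> = 0"
  unfolding eval_monomial_def
  using assms by (intro prod_zero) (auto simp: in_keys_iff zero_power intro!: bexI[of _ i])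

lemma eval_mpoly_at_0:
  fixes F :: "('v, 'a::comm_semiring_1) mpoly"
  assumes "homogeneous (Suc k) F"
  shows "eval_mpoly (\<lambda>_. 0) F = 0"
proof -
  have "eval_monomial (\<lambda>_. 0 :: 'a) \<mu> = 0" if "\<mu> \<in> keys F" for \<mu>
  proof -
    have "keys \<mu> \<noteq> {}" using assms that by (auto simp: homogeneous_def total_degree_def)
    then obtain i where "i \<in> keys \<mu>" by blast
    then show ?thesis by (rule eval_monomial_eq_0) simp
  qed
  then show ?thesis by (simp add: eval_mpoly_def)
qed

text \<open>At vectors supported in \<open>A\<close> the monomials involving other variables vanish, so dropping
  them does not change the values there.\<close>

lemma restrict_variables:
  fixes F :: "('v, 'a::comm_semiring_1) mpoly"
  assumes "homogeneous k F"
  obtains G where "keys G \<subseteq> monomials A k"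
    and "\<And>x. (\<And>i. i \<notin> A \<Longrightarrow> x i = 0) \<Longrightarrow> eval_mpoly x G = eval_mpoly x F"
proof
  define K where "K = {\<mu> \<in> keys F. keys \<mu> \<subseteq> A}"
  define G where "G = (\<Sum>\<mu>\<in>K. Poly_Mapping.single \<mu> (lookup F \<mu>))"
  have "K \<subseteq> monomials A k"
    using assms by (auto simp: K_def monomials_def homogeneous_def)
  then show "keys G \<subseteq> monomials A k"
    unfolding G_def by (intro keys_sum_monomials) auto
  fix x :: "'v \<Rightarrow> 'a" assume x: "\<And>i. i \<notin> A \<Longrightarrow> x i = 0"
  have "eval_monomial x \<mu> = 0" if "\<mu> \<in> keys F - K" for \<mu>
  proof -
    from that obtain i where "i \<in> keys \<mu>" "i \<notin> A" unfolding K_def by blast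
    with x show ?thesis by (intro eval_monomial_eq_0[of i]) auto
  qed
  then have "eval_mpoly x F = (\<Sum>\<mu>\<in>K. lookup F \<mu> * eval_monomial x \<mu>)"
    unfolding eval_mpoly_def by (intro sum.mono_neutral_right) (auto simp: K_def)
  then show "eval_mpoly x G = eval_mpoly x F"
    by (simp add: G_def eval_mpoly_sum eval_mpoly_single)
qed


section \<open>Counting monomials and algebraic independence\<close>

text \<open>All exponents but one determine a monomial of given degree. This makes the exponent of the
  bound one less than the number of variables, and the comparison of dimensions below rests on it.\<close>

lemma finite_card_monomials_le:
  assumes "finite A" "a \<in> A"
  shows "finite (monomials A k)" "card (monomials A k) \<le> (k + 1) ^ (card A - 1)"
proof -
  define r where "r = (\<lambda>\<mu> :: 'a \<Rightarrow>\<^sub>0 nat. restrict (lookup \<mu>) (A - {a}))"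
  define B where "B = PiE (A - {a}) (\<lambda>_. {..k})"
  have deg: "total_degree \<mu> = lookup \<mu> a + (\<Sum>i\<in>A - {a}. lookup \<mu> i)" if "keys \<mu> \<subseteq> A" for \<mu>
    using total_degree_superset[OF assms(1) that] sum.remove[OF assms] by metis
  have inj: "inj_on r (monomials A k)"
  proof (rule inj_onI, rule poly_mapping_eqI)
    fix \<mu> \<nu> i assume *: "\<mu> \<in> monomials A k" "\<nu> \<in> monomials A k" "r \<mu> = r \<nu>"
    have eq: "lookup \<mu> j = lookup \<nu> j" if "j \<in> A - {a}" for j
      using fun_cong[OF *(3), of j] that by (simp add: r_def)
    have "(\<Sum>i\<in>A - {a}. lookup \<mu> i) = (\<Sum>i\<in>A - {a}. lookup \<nu> i)"
      using eq by (intro sum.cong) auto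
    then have "lookup \<mu> a = lookup \<nu> a"
      using deg[of \<mu>] deg[of \<nu>] * by (simp add: monomials_def)
    moreover have "lookup \<mu> i = 0" "lookup \<nu> i = 0" if "i \<notin> A"
      using * that by (auto simp: monomials_def in_keys_iff subset_iff)
    ultimately show "lookup \<mu> i = lookup \<nu> i"
      using eq[of i] by (cases "i \<in> A"; cases "i = a") auto
  qed
  have "lookup \<mu> i \<le> k" if "\<mu> \<in> monomials A k" "i \<in> A - {a}" for \<mu> i
    using deg[of \<mu>] that member_le_sum[of i "A - {a}" "lookup \<mu>"] assms(1)
    by (auto simp: monomials_def)
  then have im: "r ` monomials A k \<subseteq> B"
    unfolding r_def B_def by (intro image_subsetI restrict_PiE_iff[THEN iffD2]) auto
  have B: "finite B" "card B = (k + 1) ^ (card A - 1)"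
    using assms by (auto simp: B_def finite_PiE card_PiE)
  show "finite (monomials A k)" using inj im B(1) by (rule inj_on_finite)
  show "card (monomials A k) \<le> (k + 1) ^ (card A - 1)"
    using card_inj_on_le[OF inj im B(1)] B(2) by simp
qed

text \<open>The first \<open>n\<close> exponents may be any numbers up to \<open>t\<close>; the last one fills up the degree.\<close>

lemma card_monomials_ge: "(t + 1) ^ n \<le> card (monomials {..<Suc n} (n * t))"
proof -
  define B where "B = PiE {..<n} (\<lambda>_. {..t})"
  define h where "h = (\<lambda>g. (\<Sum>i<n. Poly_Mapping.single i (g i)) +
    Poly_Mapping.single n (n * t - (\<Sum>i<n. g i)))"
  have look: "lookup (h g) i = (if i < n then g i else if i = n then n * t - (\<Sum>i<n. g i) else 0)"
    for g i
    by (auto simp: h_def lookup_add lookup_sum lookup_single when_def sum.delta)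
  have "inj_on h B"
  proof (rule inj_onI)
    fix g g' assume *: "g \<in> B" "g' \<in> B" "h g = h g'"
    then have "g i = g' i" if "i < n" for i using look[of g i] look[of g' i] that by simp
    with *(1,2) show "g = g'" unfolding B_def by (intro PiE_ext) auto
  qed
  moreover have "h ` B \<subseteq> monomials {..<Suc n} (n * t)"
  proof clarify
    fix g assume g: "g \<in> B"
    have sub: "keys (h g) \<subseteq> {..<Suc n}"
      by (auto simp: in_keys_iff look split: if_splits)
    have "(\<Sum>i<n. g i) \<le> (\<Sum>i<n. t)" using g by (intro sum_mono) (auto simp: B_def)
    then show "h g \<in> monomials {..<Suc n} (n * t)"
      using total_degree_superset[OF _ sub] sub by (simp add: monomials_def look)
  qed
  moreover have "finite (monomials {..<Suc n} (n * t))"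
    by (rule finite_card_monomials_le[of _ 0]) auto
  ultimately have "card B \<le> card (monomials {..<Suc n} (n * t))" by (rule card_inj_on_le)
  then show ?thesis by (simp add: B_def card_PiE)
qed

lemma in_span_singles:
  assumes "finite K" "keys H \<subseteq> K"
  shows "(H :: 'v \<Rightarrow>\<^sub>0 'a::field) \<in> module.span scale ((\<lambda>\<mu>. Poly_Mapping.single \<mu> 1) ` K)"
proof -
  interpret vs: vector_space "scale :: 'a \<Rightarrow> ('v \<Rightarrow>\<^sub>0 'a) \<Rightarrow> _" by (rule vector_space_scale)
  have "H = (\<Sum>\<mu>\<in>K. scale (lookup H \<mu>) (Poly_Mapping.single \<mu> 1))"
    using assms
    by (intro poly_mapping_eqI)
      (auto simp: lookup_sum lookup_scale lookup_single when_def if_distrib[of "(*) _"] in_keys_iff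
        cong: if_cong)
  also have "\<dots> \<in> vs.span ((\<lambda>\<mu>. Poly_Mapping.single \<mu> 1) ` K)"
    by (intro vs.span_sum vs.span_scale vs.span_base) auto
  finally show ?thesis .
qed

lemma dim_supported_in:
  assumes "finite A"
  shows "vector_space.dim scale {f :: 'v \<Rightarrow>\<^sub>0 'a::field. keys f \<subseteq> A} = card A"
proof -
  interpret vs: vector_space "scale :: 'a \<Rightarrow> ('v \<Rightarrow>\<^sub>0 'a) \<Rightarrow> _" by (rule vector_space_scale)
  let ?e = "\<lambda>\<mu> :: 'v. Poly_Mapping.single \<mu> (1 :: 'a)"
  have inj: "inj ?e"
    by (rule injI) (metis keys_single one_neq_zero singleton_inject)
  show ?thesis
  proof (rule vs.dim_unique)
    show "?e ` A \<subseteq> {f. keys f \<subseteq> A}" by auto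
    show "{f. keys f \<subseteq> A} \<subseteq> vs.span (?e ` A)"
      using in_span_singles[OF assms] by blast
    show "card (?e ` A) = card A" using inj by (meson card_image inj_on_subset subset_UNIV)
    have "u (?e \<mu>) = 0" if u: "(\<Sum>v\<in>?e ` A. scale (u v) v) = 0" and "\<mu> \<in> A" for u \<mu>
    proof -
      have "(\<Sum>\<nu>\<in>A. scale (u (?e \<nu>)) (?e \<nu>)) = 0"
        using u inj by (simp add: sum.reindex inj_on_subset[OF _ subset_UNIV] o_def)
      then have "lookup (\<Sum>\<nu>\<in>A. scale (u (?e \<nu>)) (?e \<nu>)) \<mu> = 0" by simp
      then show ?thesis
        using assms \<open>\<mu> \<in> A\<close>
        by (simp add: lookup_sum lookup_scale lookup_single when_def if_distrib[of "(*) _"] cong: if_cong)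
    qed
    then show "vs.independent (?e ` A)"
      using assms by (auto simp: vs.dependent_finite)
  qed
qed

text \<open>More vectors than the dimension are dependent. Indexing them by a set also covers the case
  of repeated vectors.\<close>

lemma linear_relation:
  fixes P :: "'i \<Rightarrow> 'v \<Rightarrow>\<^sub>0 'a::field"
  assumes "finite K" "finite I" "card K < card I" "\<And>i. i \<in> I \<Longrightarrow> keys (P i) \<subseteq> K"
  obtains c where "\<exists>i\<in>I. c i \<noteq> 0" "(\<Sum>i\<in>I. scale (c i) (P i)) = 0"
proof -
  interpret vs: vector_space "scale :: 'a \<Rightarrow> ('v \<Rightarrow>\<^sub>0 'a) \<Rightarrow> _" by (rule vector_space_scale)
  show ?thesis
  proof (cases "inj_on P I")
    case True
    have "vs.dependent (P ` I)"
    proof (rule ccontr)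
      assume "\<not> vs.dependent (P ` I)"
      moreover have "P ` I \<subseteq> vs.span ((\<lambda>\<mu>. Poly_Mapping.single \<mu> 1) ` K)"
        using in_span_singles[OF assms(1)] assms(4) by blast
      ultimately have "card (P ` I) \<le> card ((\<lambda>\<mu>. Poly_Mapping.single \<mu> (1 :: 'a)) ` K)"
        using vs.independent_span_bound[of "(\<lambda>\<mu>. Poly_Mapping.single \<mu> 1) ` K" "P ` I"] assms(1)
        by simp
      also have "\<dots> \<le> card K" using assms(1) by (rule card_image_le)
      finally show False using assms(3) card_image[OF True] by simp
    qed
    then obtain u where "\<exists>v\<in>P ` I. u v \<noteq> 0" "(\<Sum>v\<in>P ` I. scale (u v) v) = 0"
      using assms(2) by (auto simp: vs.dependent_finite)
    then show thesis
      using that[of "\<lambda>i. u (P i)"] by (auto simp: sum.reindex[OF True])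
  next
    case False
    then obtain i j where ij: "i \<in> I" "j \<in> I" "i \<noteq> j" "P i = P j" by (auto simp: inj_on_def)
    \<comment> \<open>A repeated vector gives the relation \<open>P i - P j = 0\<close>.\<close>
    define c where "c = (\<lambda>k. if k = i then 1 else if k = j then - 1 else (0 :: 'a))"
    have "(\<Sum>k\<in>I. scale (c k) (P k)) = (\<Sum>k\<in>{i, j}. scale (c k) (P k))"
      using ij assms(2) by (intro sum.mono_neutral_right) (auto simp: c_def)
    also have "\<dots> = 0" using ij by (simp add: c_def)
    finally have "(\<Sum>k\<in>I. scale (c k) (P k)) = 0" .
    moreover have "\<exists>k\<in>I. c k \<noteq> 0" using ij(1) by (auto simp: c_def)
    ultimately show thesis using that by blast
  qed
qed

text \<open>The images under \<open>F\<close> of the monomials of degree \<open>n * t\<close> in \<open>r\<close> variables lie in a space of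
  dimension of order \<open>t ^ (card A - 1)\<close>, while there are about \<open>t ^ (r - 1)\<close> of them. So they are
  dependent for large \<open>t\<close> if \<open>r\<close> exceeds \<open>card A\<close>, that is, the forms \<open>F\<close> satisfy a
  homogeneous relation.\<close>

lemma card_algebraically_independent_le:
  fixes F :: "nat \<Rightarrow> ('v, 'a::field) mpoly"
  assumes A: "finite A" "A \<noteq> {}"
    and F: "\<And>i. i < r \<Longrightarrow> keys (F i) \<subseteq> monomials A e"
    and indep: "\<And>k G. keys G \<subseteq> monomials {..<r} k \<Longrightarrow>
      (\<And>x. eval_mpoly (\<lambda>i. eval_mpoly x (F i)) G = 0) \<Longrightarrow> G = 0"
  shows "r \<le> card A"
proof (rule ccontr)
  assume "\<not> r \<le> card A"
  then obtain n where r: "r = Suc n" and n: "card A \<le> n" by (cases r) auto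
  \<comment> \<open>With this \<open>t\<close> the bound \<open>(n * t * e + 1) ^ (card A - 1)\<close> on the dimension is at most
    \<open>t * (t + 1) ^ (card A - 1)\<close>, which is less than \<open>(t + 1) ^ n\<close>.\<close>
  define t where "t = (e * n + 1) ^ (card A - 1)"
  obtain a where a: "a \<in> A" using A(2) by blast
  let ?I = "monomials {..<r} (n * t)" and ?K = "monomials A (n * t * e)"
  have card_A: "0 < card A" using A by (simp add: card_gt_0_iff)
  have "card ?K \<le> (n * t * e + 1) ^ (card A - 1)"
    by (rule finite_card_monomials_le(2)[OF A(1) a])
  also have "\<dots> \<le> ((e * n + 1) * (t + 1)) ^ (card A - 1)"
    by (intro power_mono) (auto simp: algebra_simps)
  also have "\<dots> = t * (t + 1) ^ (card A - 1)" by (simp only: power_mult_distrib flip: t_def)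
  also have "\<dots> < (t + 1) * (t + 1) ^ (card A - 1)" by simp
  also have "\<dots> = (t + 1) ^ card A" using card_A by (simp flip: power_Suc)
  also have "\<dots> \<le> (t + 1) ^ n" using n by (intro power_increasing) auto
  also have "\<dots> \<le> card ?I" unfolding r by (rule card_monomials_ge)
  finally have less: "card ?K < card ?I" .
  have fin: "finite ?I" "finite ?K"
    using finite_card_monomials_le(1)[of "{..<r}" 0] r finite_card_monomials_le(1)[OF A(1) a] by auto
  have "keys (eval_monomial F \<mu>) \<subseteq> ?K" if "\<mu> \<in> ?I" for \<mu>
    using F that by (intro keys_eval_monomial) auto
  then obtain c where c: "\<exists>\<mu>\<in>?I. c \<mu> \<noteq> 0" "(\<Sum>\<mu>\<in>?I. scale (c \<mu>) (eval_monomial F \<mu>)) = 0"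
    by (rule linear_relation[OF fin(2,1) less])
  define G where "G = (\<Sum>\<mu>\<in>?I. Poly_Mapping.single \<mu> (c \<mu>))"
  have "keys G \<subseteq> ?I" unfolding G_def by (intro keys_sum_monomials) auto
  moreover have "eval_mpoly (\<lambda>i. eval_mpoly x (F i)) G = 0" for x
  proof -
    have "eval_mpoly (\<lambda>i. eval_mpoly x (F i)) G =
        eval_mpoly x (\<Sum>\<mu>\<in>?I. scale (c \<mu>) (eval_monomial F \<mu>))"
      by (simp add: G_def eval_mpoly_sum eval_mpoly_single eval_mpoly_scale_coeffs
          eval_mpoly_eval_monomial)
    then show ?thesis using c(2) by simp
  qed
  ultimately have "G = 0" by (rule indep)
  moreover have "lookup G \<mu> = c \<mu>" if "\<mu> \<in> ?I" for \<mu>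
    using that fin(1) by (simp add: G_def lookup_sum lookup_single when_def sum.delta)
  ultimately show False using c(1) by auto
qed

lemma compose_forms:
  fixes F :: "'i \<Rightarrow> ('v, 'a::comm_semiring_1) mpoly"
  assumes "\<And>i. i \<in> B \<Longrightarrow> homogeneous e (F i)" "keys G \<subseteq> monomials B k"
  obtains H where "homogeneous (k * e) H"
    and "\<And>x. eval_mpoly x H = eval_mpoly (\<lambda>i. eval_mpoly x (F i)) G"
proof
  let ?H = "\<Sum>\<mu>\<in>keys G. scale (lookup G \<mu>) (eval_monomial F \<mu>)"
  have "keys (eval_monomial F \<mu>) \<subseteq> monomials UNIV (k * e)" if "\<mu> \<in> keys G" for \<mu>
    using assms that by (intro keys_eval_monomial[of B]) (auto simp: homogeneous_iff_monomials)
  then have "keys ?H \<subseteq> monomials UNIV (k * e)"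
    by (intro keys_sum_monomials order_trans[OF keys_scale_subset])
  then show "homogeneous (k * e) ?H" by (rule homogeneous_if_monomials)
  show "eval_mpoly x ?H = eval_mpoly (\<lambda>i. eval_mpoly x (F i)) G" for x
    by (simp add: eval_mpoly_sum eval_mpoly_scale_coeffs eval_mpoly_eval_monomial)
      (simp add: eval_mpoly_def)
qed

lemma diff_single_add:
  fixes \<mu> :: "'v \<Rightarrow>\<^sub>0 nat"
  assumes "i \<in> keys \<mu>"
  shows "\<mu> - Poly_Mapping.single i 1 + Poly_Mapping.single i 1 = \<mu>"
  using assms
  by (intro poly_mapping_eqI) (auto simp: lookup_add lookup_minus lookup_single when_def in_keys_iff)

lemma split_off_variable:
  fixes G :: "('v, 'a::comm_semiring_1) mpoly"
  assumes G: "keys G \<subseteq> monomials A (Suc k)"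
  obtains G0 G1 where "keys G0 \<subseteq> monomials (A - {i}) (Suc k)" "keys G1 \<subseteq> monomials A k"
    and "G = G0 + G1 * Poly_Mapping.single (Poly_Mapping.single i 1) 1"
proof
  let ?X = "Poly_Mapping.single (Poly_Mapping.single i 1) 1 :: ('v, 'a) mpoly"
  let ?K0 = "{\<mu> \<in> keys G. i \<notin> keys \<mu>}" and ?K1 = "{\<mu> \<in> keys G. i \<in> keys \<mu>}"
  let ?G0 = "\<Sum>\<mu>\<in>?K0. Poly_Mapping.single \<mu> (lookup G \<mu>)"
  let ?G1 = "\<Sum>\<mu>\<in>?K1. Poly_Mapping.single (\<mu> - Poly_Mapping.single i 1) (lookup G \<mu>)"
  show "keys ?G0 \<subseteq> monomials (A - {i}) (Suc k)"
    using G by (intro keys_sum_monomials) (auto simp: monomials_def)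
  show "keys ?G1 \<subseteq> monomials A k"
  proof (rule keys_sum_monomials)
    fix \<mu> assume \<mu>: "\<mu> \<in> ?K1"
    let ?\<nu> = "\<mu> - Poly_Mapping.single i 1"
    have "total_degree \<mu> = total_degree ?\<nu> + 1"
      using diff_single_add[of i \<mu>] \<mu> total_degree_add[of ?\<nu> "Poly_Mapping.single i 1"]
      by (simp add: total_degree_def)
    moreover have "keys ?\<nu> \<subseteq> keys \<mu>" by (auto simp: in_keys_iff lookup_minus)
    ultimately have "?\<nu> \<in> monomials A k" using G \<mu> by (auto simp: monomials_def)
    then show "keys (Poly_Mapping.single ?\<nu> (lookup G \<mu>)) \<subseteq> monomials A k" by simp
  qed
  have "?G1 * ?X = (\<Sum>\<mu>\<in>?K1. Poly_Mapping.single \<mu> (lookup G \<mu>))"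
    by (simp add: sum_distrib_right mult_single diff_single_add[simplified])
  moreover have "G = ?G0 + (\<Sum>\<mu>\<in>?K1. Poly_Mapping.single \<mu> (lookup G \<mu>))"
    by (subst mpoly_sum_monomials[of G], subst sum.union_disjoint[symmetric])
      (auto intro!: sum.cong)
  ultimately show "G = ?G0 + ?G1 * ?X" by simp
qed

text \<open>Along an ascending chain of cones, let each form \<open>F i\<close> vanish on one cone and be a
  nonzerodivisor on the next. In a relation between the forms that holds on the largest cone, the
  terms free of the last form give a relation on the cone below, where the last form is zero; so
  they cancel by induction, and the last form can be divided out of the rest.\<close>

lemma algebraically_independent_on_chain:
  fixes F :: "nat \<Rightarrow> ('v, 'a::comm_ring_1) mpoly" and C :: "nat \<Rightarrow> ('v \<Rightarrow> 'a) set"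
  assumes "C 0 \<noteq> {}" and "\<And>i. i < r \<Longrightarrow> C i \<subseteq> C (Suc i)"
    and "\<And>i. i < r \<Longrightarrow> homogeneous e (F i)"
    and "\<And>i x. i < r \<Longrightarrow> x \<in> C i \<Longrightarrow> eval_mpoly x (F i) = 0"
    and "\<And>i k H. i < r \<Longrightarrow> homogeneous k H \<Longrightarrow>
      \<forall>x\<in>C (Suc i). eval_mpoly x (F i) * eval_mpoly x H = 0 \<Longrightarrow>
      \<forall>x\<in>C (Suc i). eval_mpoly x H = 0"
    and "keys G \<subseteq> monomials {..<r} k"
    and "\<forall>x\<in>C r. eval_mpoly (\<lambda>i. eval_mpoly x (F i)) G = 0"
  shows "G = 0"
  using assms
proof (induction r arbitrary: k G)
  case 0
  obtain x where x: "x \<in> C 0" using "0.prems"(1) by blast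
  have "monomials {..<0 :: nat} k \<subseteq> {0}" by (auto simp: monomials_def)
  then have keys: "keys G \<subseteq> {0}" using "0.prems"(6) by blast
  then have "eval_mpoly y G = lookup G 0" for y by (subst eval_mpoly_superset[of "{0}"]) auto
  then have "0 \<notin> keys G" using "0.prems"(7) x by (auto simp: in_keys_iff)
  then show ?case using keys by (simp flip: keys_eq_empty) blast
next
  case (Suc r)
  let ?y = "\<lambda>x i. eval_mpoly x (F i)"
  note hom = Suc.prems(3) and vanish = Suc.prems(4) and nonzerodivisor = Suc.prems(5)
  have CSuc: "C r \<subseteq> C (Suc r)" by (rule Suc.prems(2)) simp
  have IH: "G = 0" if "keys G \<subseteq> monomials {..<r} k" "\<forall>x\<in>C r. eval_mpoly (?y x) G = 0" for G k
  proof (rule Suc.IH[OF Suc.prems(1) _ _ _ _ that])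
    fix i assume "i < r"
    then have i: "i < Suc r" by simp
    show "C i \<subseteq> C (Suc i)" "homogeneous e (F i)" by (rule Suc.prems(2) hom, rule i)+
    show "eval_mpoly x (F i) = 0" if "x \<in> C i" for x using i that by (rule vanish)
    show "\<forall>x\<in>C (Suc i). eval_mpoly x H = 0" if "homogeneous l H"
      "\<forall>x\<in>C (Suc i). eval_mpoly x (F i) * eval_mpoly x H = 0" for l H
      using i that by (rule nonzerodivisor)
  qed
  from Suc.prems(6,7) show ?case
  proof (induction k arbitrary: G)
    case 0
    then show ?case using IH[of G 0] CSuc by (auto simp: monomials_degree_0)
  next
    case (Suc k)
    have "{..<Suc r} - {r} = {..<r}" by auto
    then obtain G0 G1 where G0: "keys G0 \<subseteq> monomials {..<r} (Suc k)"
      and G1: "keys G1 \<subseteq> monomials {..<Suc r} k"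
      and G: "G = G0 + G1 * Poly_Mapping.single (Poly_Mapping.single r 1) 1"
      using split_off_variable[OF Suc.prems(1), of r] by metis
    have eval_G: "eval_mpoly y G = eval_mpoly y G0 + y r * eval_mpoly y G1" for y
      using eval_mpoly_variable[of y r 1] by (simp add: G eval_mpoly_add eval_mpoly_mult mult.commute)
    have "eval_mpoly (?y x) G0 = 0" if "x \<in> C r" for x
      using eval_G[of "?y x"] vanish[of r x] Suc.prems(2) CSuc that by auto
    then have [simp]: "G0 = 0" using IH[OF G0] by blast
    obtain H where H: "homogeneous (k * e) H" "\<And>x. eval_mpoly x H = eval_mpoly (?y x) G1"
      by (rule compose_forms[OF hom G1]) auto
    have "\<forall>x\<in>C (Suc r). eval_mpoly x (F r) * eval_mpoly x H = 0"
      using Suc.prems(2) eval_G H(2) by simp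
    then have "\<forall>x\<in>C (Suc r). eval_mpoly (?y x) G1 = 0"
      using nonzerodivisor[OF _ H(1), of r] H(2) by simp
    then have "G1 = 0" using Suc.IH[OF G1] by blast
    then show ?case by (simp add: G)
  qed
qed

section \<open>Points, closed sets and irreducible sets in homogeneous coordinates\<close>

definition coordinate_space :: "'v set \<Rightarrow> ('v \<Rightarrow>\<^sub>0 'a::zero) set" where
  "coordinate_space A = {f. keys f \<subseteq> A}"

lemma lookup_coordinate_space: "f \<in> coordinate_space A \<Longrightarrow> i \<notin> A \<Longrightarrow> lookup f i = 0"
  by (auto simp: coordinate_space_def in_keys_iff)

lemma scale_1 [simp]: "scale 1 f = f"
  by (rule poly_mapping_eqI) (simp add: lookup_scale)

lemma proj_point_self: "f \<in> proj_point f"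
  unfolding proj_point_def by (metis (mono_tags, lifting) mem_Collect_eq one_neq_zero scale_1)

lemma proj_point_in_zero_locus:
  assumes "\<forall>F\<in>S. \<exists>k. homogeneous k F" "f \<in> V - {0}"
  shows "proj_point f \<in> zero_locus V S \<longleftrightarrow> (\<forall>F\<in>S. eval_mpoly (lookup f) F = 0)"
  using assms vanishes_at_proj_point by (fastforce simp: zero_locus_def proj_space_def)

lemma closedin_zero_locus: "homogeneous k F \<Longrightarrow> closedin (zariski V) (zero_locus V {F})"
  unfolding closedin_zariski by blast

text \<open>Multiplying by a coordinate makes the degree of the separating form positive, so it
  also vanishes at the origin; a vector at which it is nonzero represents a point.\<close>

lemma separating_form:
  assumes "closedin (zariski V) C" "f \<in> V - {0}" "proj_point f \<notin> C"
  obtains k F where "homogeneous (Suc k) F" "eval_mpoly (lookup f) F \<noteq> 0"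
    and "\<And>g. g \<in> V - {0} \<Longrightarrow> proj_point g \<in> C \<Longrightarrow> eval_mpoly (lookup g) F = 0"
proof -
  obtain S where S: "\<forall>F\<in>S. \<exists>k. homogeneous k F" "C = zero_locus V S"
    using assms(1) by (auto simp: closedin_zariski)
  then obtain F where F: "F \<in> S" "eval_mpoly (lookup f) F \<noteq> 0"
    using assms(2,3) proj_point_in_zero_locus[OF S(1)] by auto
  then obtain k where k: "homogeneous k F" using S(1) by blast
  have "keys f \<noteq> {}" using assms(2) by (metis DiffD2 insertI1 keys_eq_empty)
  then obtain i where "i \<in> keys f" by blast
  then have i: "lookup f i \<noteq> 0" by (simp add: in_keys_iff)
  let ?X = "Poly_Mapping.single (Poly_Mapping.single i 1) 1"
  show thesis
  proof
    show "homogeneous (Suc k) (F * ?X)"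
      using homogeneous_mult[OF k homogeneous_variable[of i 1]] by simp
    show "eval_mpoly (lookup f) (F * ?X) \<noteq> 0"
      using F(2) i eval_mpoly_variable[of "lookup f" i 1] by (simp add: eval_mpoly_mult)
    show "eval_mpoly (lookup g) (F * ?X) = 0" if "g \<in> V - {0}" "proj_point g \<in> C" for g
      using that F(1) proj_point_in_zero_locus[OF S(1)] by (simp add: S(2) eval_mpoly_mult)
  qed
qed

lemma separating_form_subtopology:
  assumes "closedin (subtopology (zariski V) W) Z" "f \<in> V - {0}" "proj_point f \<in> W - Z"
  obtains k F where "homogeneous (Suc k) F" "eval_mpoly (lookup f) F \<noteq> 0"
    and "\<And>g. g \<in> V - {0} \<Longrightarrow> proj_point g \<in> Z \<Longrightarrow> eval_mpoly (lookup g) F = 0"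
proof -
  obtain C where C: "closedin (zariski V) C" "Z = C \<inter> W"
    using assms(1) by (auto simp: closedin_subtopology)
  then obtain k F where "homogeneous (Suc k) F" "eval_mpoly (lookup f) F \<noteq> 0"
    and "\<And>g. g \<in> V - {0} \<Longrightarrow> proj_point g \<in> C \<Longrightarrow> eval_mpoly (lookup g) F = 0"
    using separating_form[OF C(1) assms(2)] assms(3) by blast
  then show thesis using that C(2) by blast
qed

lemma basic_open_neighbourhood:
  assumes "openin (zariski V) W" "f \<in> V - {0}" "proj_point f \<in> W"
  obtains k F where "homogeneous (Suc k) F" "eval_mpoly (lookup f) F \<noteq> 0"
    and "\<And>g. g \<in> V - {0} \<Longrightarrow> eval_mpoly (lookup g) F \<noteq> 0 \<Longrightarrow> proj_point g \<in> W"
proof -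
  have "closedin (zariski V) (proj_space V - W)"
    using assms(1) by (metis closedin_diff closedin_topspace topspace_zariski)
  then obtain k F where F: "homogeneous (Suc k) F" "eval_mpoly (lookup f) F \<noteq> 0"
    "\<And>g. g \<in> V - {0} \<Longrightarrow> proj_point g \<in> proj_space V - W \<Longrightarrow> eval_mpoly (lookup g) F = 0"
    using separating_form[OF _ assms(2)] assms(3) by blast
  have "proj_point g \<in> W" if "g \<in> V - {0}" "eval_mpoly (lookup g) F \<noteq> 0" for g
    using F(3)[OF that(1)] that by (auto simp: proj_space_def)
  then show thesis using that F(1,2) by blast
qed

lemma eval_at_vector_0:
  fixes F :: "('v, 'a::comm_semiring_1) mpoly"
  assumes "homogeneous (Suc k) F"
  shows "eval_mpoly (lookup 0) F = 0"
proof -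
  have "lookup (0 :: 'v \<Rightarrow>\<^sub>0 'a) = (\<lambda>_. 0)" by auto
  then show ?thesis using eval_mpoly_at_0[OF assms] by simp
qed

lemma irreducible_nonzerodivisor:
  assumes Z: "irreducible_subset (subtopology (zariski V) W) Z"
    and F: "homogeneous k F" "f \<in> V - {0}" "proj_point f \<in> Z" "eval_mpoly (lookup f) F \<noteq> 0"
    and H: "homogeneous l H"
    and FH: "\<And>g. g \<in> V - {0} \<Longrightarrow> proj_point g \<in> Z \<Longrightarrow>
      eval_mpoly (lookup g) F * eval_mpoly (lookup g) H = 0"
    and g: "g \<in> V - {0}" "proj_point g \<in> Z"
  shows "eval_mpoly (lookup g) H = 0"
proof -
  let ?A = "zero_locus V {F} \<inter> W" and ?B = "zero_locus V {H} \<inter> W"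
  have Z_sub: "Z \<subseteq> proj_space V \<inter> W"
    using Z by (simp add: irreducible_subset_def)
  have "Z \<subseteq> ?A \<union> ?B"
  proof
    fix p assume p: "p \<in> Z"
    then obtain h where h: "h \<in> V - {0}" "p = proj_point h"
      using Z_sub by (auto simp: proj_space_def)
    then have "eval_mpoly (lookup h) F = 0 \<or> eval_mpoly (lookup h) H = 0" using FH p by auto
    then show "p \<in> ?A \<union> ?B"
      using p h Z_sub F(1) H proj_point_in_zero_locus[of "{F}" h V]
        proj_point_in_zero_locus[of "{H}" h V] by auto
  qed
  moreover have "closedin (subtopology (zariski V) W) ?A" "closedin (subtopology (zariski V) W) ?B"
    using closedin_zero_locus[OF F(1)] closedin_zero_locus[OF H]
    by (auto simp: closedin_subtopology)
  ultimately have "Z \<subseteq> ?A \<or> Z \<subseteq> ?B" using Z unfolding irreducible_subset_def by blast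
  moreover have "\<not> Z \<subseteq> ?A"
    using F proj_point_in_zero_locus[of "{F}" f V] by auto
  ultimately show ?thesis
    using g H proj_point_in_zero_locus[of "{H}" g V] by auto
qed


section \<open>Krull dimension is at most the dimension of the projective space\<close>

text \<open>In a chain of irreducible closed sets, choose for every member a form that vanishes on the
  previous member but not on the member itself. Powers of these forms have a common degree, and by
  irreducibility each of them is a nonzerodivisor on its member of the chain. The cones over the
  members, with the origin added in front, therefore make the forms algebraically independent, and
  there are no more than \<open>card A\<close> such forms.\<close>

lemma krull_dim_subtopology_le:
  fixes V :: "('v \<Rightarrow>\<^sub>0 'a::field) set"
  assumes A: "finite A" and V: "V = coordinate_space A"
  shows "krull_dim (subtopology (zariski V) W) \<le> enat (card A - 1)"
  unfolding krull_dim_def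
proof (rule Sup_least, clarify)
  let ?T = "subtopology (zariski V) W"
  fix n and Z :: "nat \<Rightarrow> ('v \<Rightarrow>\<^sub>0 'a) set set"
  assume Z: "\<forall>i\<le>n. closedin ?T (Z i) \<and> irreducible_subset ?T (Z i)"
    and chain: "\<forall>i<n. Z i \<subset> Z (Suc i)"
  have Z_sub: "Z i \<subseteq> proj_space V \<inter> W" if "i \<le> n" for i
    using Z that by (simp add: irreducible_subset_def)
  define Y where "Y i = (if i = 0 then {} else Z (i - 1))" for i
  have "\<exists>k F. homogeneous (Suc k) F \<and>
      (\<exists>f\<in>V - {0}. proj_point f \<in> Z i \<and> eval_mpoly (lookup f) F \<noteq> 0) \<and>
      (\<forall>g\<in>V - {0}. proj_point g \<in> Y i \<longrightarrow> eval_mpoly (lookup g) F = 0)" if "i \<le> n" for i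
  proof -
    have "Y i \<subset> Z i"
      using Z chain that by (cases i) (auto simp: Y_def irreducible_subset_def)
    then obtain p where p: "p \<in> Z i - Y i" by blast
    moreover note Zi = Z_sub[OF that]
    ultimately obtain f where f: "f \<in> V - {0}" "p = proj_point f"
      by (auto simp: proj_space_def)
    have "closedin ?T (Y i)" using Z that by (auto simp: Y_def)
    then obtain k F where "homogeneous (Suc k) F" "eval_mpoly (lookup f) F \<noteq> 0"
      "\<And>g. g \<in> V - {0} \<Longrightarrow> proj_point g \<in> Y i \<Longrightarrow> eval_mpoly (lookup g) F = 0"
      by (rule separating_form_subtopology[OF _ f(1)]) (use p f Zi in auto)
    then show ?thesis using p f by blast
  qed
  then obtain k F where F: "\<And>i. i \<le> n \<Longrightarrow> homogeneous (Suc (k i)) (F i)"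
      "\<And>i. i \<le> n \<Longrightarrow> \<exists>f\<in>V - {0}. proj_point f \<in> Z i \<and> eval_mpoly (lookup f) (F i) \<noteq> 0"
      "\<And>i g. i \<le> n \<Longrightarrow> g \<in> V - {0} \<Longrightarrow> proj_point g \<in> Y i \<Longrightarrow> eval_mpoly (lookup g) (F i) = 0"
    by metis
  \<comment> \<open>Raise the forms to powers of the common degree \<open>e\<close> and drop the variables outside \<open>A\<close>.\<close>
  define e where "e = (\<Prod>i\<le>n. Suc (k i))"
  define q where "q i = e div Suc (k i)" for i
  have q: "q i * Suc (k i) = e" "q i \<noteq> 0" if "i \<le> n" for i
  proof -
    have "Suc (k i) dvd e" unfolding e_def by (rule dvd_prodI) (use that in auto)
    then show "q i * Suc (k i) = e" unfolding q_def by (rule dvd_div_mult_self)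
    moreover have "e \<noteq> 0" by (simp add: e_def)
    ultimately show "q i \<noteq> 0" by (metis mult_0)
  qed
  have hom: "homogeneous e (F i ^ q i)" if "i \<le> n" for i
    using keys_power_monomials[of "F i" UNIV "Suc (k i)" "q i"] F(1)[OF that] q(1)[OF that]
    by (simp add: homogeneous_iff_monomials)
  have "\<exists>G. keys G \<subseteq> monomials A e \<and>
      (\<forall>x. (\<forall>j. j \<notin> A \<longrightarrow> x j = 0) \<longrightarrow> eval_mpoly x G = eval_mpoly x (F i ^ q i))" if "i \<le> n" for i
    using restrict_variables[OF hom[OF that]] by metis
  then obtain G where G: "\<And>i. i \<le> n \<Longrightarrow> keys (G i) \<subseteq> monomials A e"
    and eval_G': "\<And>i x. i \<le> n \<Longrightarrow> (\<forall>j. j \<notin> A \<longrightarrow> x j = 0) \<Longrightarrow>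
      eval_mpoly x (G i) = eval_mpoly x (F i ^ q i)"
    by metis
  have eval_G: "eval_mpoly (lookup f) (G i) = eval_mpoly (lookup f) (F i) ^ q i"
    if "i \<le> n" "f \<in> V" for i f
  proof -
    have "\<forall>j. j \<notin> A \<longrightarrow> lookup f j = 0"
      using lookup_coordinate_space[of f A] that(2) unfolding V by blast
    from eval_G'[OF that(1) this] show ?thesis by (simp add: eval_mpoly_power)
  qed
  have "e > 0" by (simp add: e_def)
  then have G_0: "eval_mpoly (\<lambda>_. 0) (G i) = 0" if "i \<le> n" for i
    using eval_mpoly_at_0[of "e - 1" "G i"] homogeneous_if_monomials[OF G[OF that]] by simp
  \<comment> \<open>The cone over \<open>Z (i - 1)\<close>, with the origin as the cone at \<open>i = 0\<close>: a form of positive degree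
    vanishes there, so \<open>n + 1\<close> closed sets carry \<open>n + 1\<close> independent forms.\<close>
  define C where "C i = insert (\<lambda>_. 0) (lookup ` {f \<in> V - {0}. proj_point f \<in> Y i})" for i
  have "Suc n \<le> card A"
  proof (rule card_algebraically_independent_le[OF A])
    obtain f where f: "f \<in> V - {0}" using F(2) by blast
    then show "A \<noteq> {}" by (auto simp: V coordinate_space_def)
    show "keys (G i) \<subseteq> monomials A e" if "i < Suc n" for i using G that by simp
    fix l R assume R: "keys R \<subseteq> monomials {..<Suc n} l"
      and R_0: "\<And>x. eval_mpoly (\<lambda>i. eval_mpoly x (G i)) R = 0"
    show "R = 0"
    proof (rule algebraically_independent_on_chain[where F = G and C = C, OF _ _ _ _ _ R])
      show "C 0 \<noteq> {}" by (simp add: C_def)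
      show "C i \<subseteq> C (Suc i)" if "i < Suc n" for i
      proof -
        have "Y i \<subseteq> Y (Suc i)" using chain that by (cases i) (auto simp: Y_def)
        then show ?thesis by (auto simp: C_def)
      qed
      show "homogeneous e (G i)" if "i < Suc n" for i
        using homogeneous_if_monomials[OF G] that by simp
      show "eval_mpoly x (G i) = 0" if "i < Suc n" "x \<in> C i" for i x
        using that F(3)[of i] q(2)[of i] G_0[of i] by (auto simp: C_def eval_G)
      show "\<forall>x\<in>C r. eval_mpoly (\<lambda>i. eval_mpoly x (G i)) R = 0" for r using R_0 by blast
    next
      fix i m H assume i: "i < Suc n" and H: "homogeneous m H"
        and GH: "\<forall>x\<in>C (Suc i). eval_mpoly x (G i) * eval_mpoly x H = 0"
      then obtain f where f: "f \<in> V - {0}" "proj_point f \<in> Z i" "eval_mpoly (lookup f) (G i) \<noteq> 0"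
        using F(2)[of i] by (auto simp: eval_G)
      have H_0: "eval_mpoly (lookup g) H = 0" if "g \<in> V - {0}" "proj_point g \<in> Z i" for g
      proof (rule irreducible_nonzerodivisor[OF _ homogeneous_if_monomials[OF G] f H _ that])
        show "irreducible_subset ?T (Z i)" "i \<le> n" using Z i by auto
        show "eval_mpoly (lookup h) (G i) * eval_mpoly (lookup h) H = 0"
          if "h \<in> V - {0}" "proj_point h \<in> Z i" for h
          using GH that by (auto simp: C_def Y_def)
      qed
      \<comment> \<open>\<open>H\<close> may be constant, but it has a zero, so it also vanishes at the origin.\<close>
      have "lookup (scale 0 f) = (\<lambda>_. 0)" by (auto simp: lookup_scale)
      then have "eval_mpoly (\<lambda>_. 0) H = 0" using eval_mpoly_scale[OF H, of 0 f] H_0[OF f(1,2)] by simp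
      then show "\<forall>x\<in>C (Suc i). eval_mpoly x H = 0" using H_0 by (auto simp: C_def Y_def)
    qed
  qed
  then show "enat n \<le> enat (card A - 1)" by simp
qed

section \<open>Forms on a line\<close>

definition line_poly :: "('v \<Rightarrow> 'a::comm_semiring_1) \<Rightarrow> ('v \<Rightarrow> 'a) \<Rightarrow> ('v, 'a) mpoly \<Rightarrow> 'a poly" where
  "line_poly x y F = (\<Sum>\<mu>\<in>keys F. smult (lookup F \<mu>) (eval_monomial (\<lambda>i. [:x i, y i:]) \<mu>))"

lemma poly_line_poly: "poly (line_poly x y F) t = eval_mpoly (\<lambda>i. x i + t * y i) F"
  by (simp add: line_poly_def poly_sum eval_mpoly_def eval_monomial_def poly_prod)

lemma poly_line_poly_vectors:
  "poly (line_poly (lookup f) (lookup g) F) t = eval_mpoly (lookup (f + scale t g)) F"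
  by (simp add: poly_line_poly lookup_add lookup_scale fun_eq_iff
      arg_cong[where f = "\<lambda>x. eval_mpoly x F"])

text \<open>If one form is nonzero at \<open>f\<close> and another at \<open>g\<close>, then neither restricts to zero on the line
  through \<open>f\<close> and \<open>g\<close>. The restrictions have finitely many zeros, and the line has infinitely many
  points.\<close>

lemma common_nonzero_on_line:
  fixes f g :: "'v \<Rightarrow>\<^sub>0 'a::field"
  assumes "infinite (UNIV :: 'a set)"
    and "eval_mpoly (lookup f) F \<noteq> 0" "eval_mpoly (lookup g) G \<noteq> 0"
  obtains t where "eval_mpoly (lookup (f + scale t (g - f))) F \<noteq> 0"
    and "eval_mpoly (lookup (f + scale t (g - f))) G \<noteq> 0"
proof -
  let ?l = "line_poly (lookup f) (lookup (g - f))"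
  have "poly (?l F) 0 \<noteq> 0" "poly (?l G) 1 \<noteq> 0"
    using assms(2,3) by (simp_all add: poly_line_poly lookup_minus)
  then have "?l F * ?l G \<noteq> 0" by auto
  then have "finite {t. poly (?l F * ?l G) t = 0}" by (rule poly_roots_finite)
  then obtain t where "poly (?l F * ?l G) t \<noteq> 0" using assms(1) ex_new_if_finite by blast
  then show thesis using that[of t] by (simp add: poly_line_poly_vectors)
qed


section \<open>Krull dimension of a nonempty open subset\<close>

lemma proj_point_in_proj_space_iff:
  assumes "module.subspace scale (L :: ('v \<Rightarrow>\<^sub>0 'a::field) set)"
  shows "proj_point f \<in> proj_space L \<longleftrightarrow> f \<in> L - {0}"
proof
  interpret vs: vector_space "scale :: 'a \<Rightarrow> ('v \<Rightarrow>\<^sub>0 'a) \<Rightarrow> _" by (rule vector_space_scale)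
  assume "proj_point f \<in> proj_space L"
  then obtain g where g: "g \<in> L - {0}" "proj_point f = proj_point g" by (auto simp: proj_space_def)
  then have "f \<in> proj_point g" using proj_point_self by metis
  then obtain c where "c \<noteq> 0" "f = scale c g" by (auto simp: proj_point_def)
  then show "f \<in> L - {0}" using g(1) vs.subspace_scale[OF assms] by auto
qed (auto simp: proj_space_def)

text \<open>If two closed sets fail to contain \<open>proj_space L \<inter> W\<close>, so does their union: on the line through
  a point missed by one and a point missed by the other, the forms witnessing this and the form
  cutting out a neighbourhood in \<open>W\<close> have a common nonzero.\<close>

lemma irreducible_linear_subspace:
  fixes L V :: "('v \<Rightarrow>\<^sub>0 'a::field) set"
  assumes inf: "infinite (UNIV :: 'a set)"
    and L: "module.subspace scale L" "L \<subseteq> V"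
    and W: "openin (zariski V) W" and nonempty: "proj_space L \<inter> W \<noteq> {}"
  shows "irreducible_subset (subtopology (zariski V) W) (proj_space L \<inter> W)"
  unfolding irreducible_subset_def
proof (intro conjI allI impI nonempty)
  interpret vs: vector_space "scale :: 'a \<Rightarrow> ('v \<Rightarrow>\<^sub>0 'a) \<Rightarrow> _" by (rule vector_space_scale)
  show "proj_space L \<inter> W \<subseteq> topspace (subtopology (zariski V) W)"
    using L(2) by (auto simp: proj_space_def)
  fix A B
  assume AB: "closedin (subtopology (zariski V) W) A \<and> closedin (subtopology (zariski V) W) B \<and>
    proj_space L \<inter> W \<subseteq> A \<union> B"
  show "proj_space L \<inter> W \<subseteq> A \<or> proj_space L \<inter> W \<subseteq> B"
  proof (rule ccontr)
    assume "\<not> ?thesis"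
    then obtain f g where f: "f \<in> L - {0}" "proj_point f \<in> W - A"
      and g: "g \<in> L - {0}" "proj_point g \<in> W - B"
      by (auto simp: proj_space_def)
    have fV: "f \<in> V - {0}" "g \<in> V - {0}" using f g L(2) by auto
    obtain k F where F: "homogeneous (Suc k) F" "eval_mpoly (lookup f) F \<noteq> 0"
      "\<And>h. h \<in> V - {0} \<Longrightarrow> proj_point h \<in> A \<Longrightarrow> eval_mpoly (lookup h) F = 0"
      using separating_form_subtopology[of V W A f] AB fV f(2) by metis
    obtain l G where G: "homogeneous (Suc l) G" "eval_mpoly (lookup g) G \<noteq> 0"
      "\<And>h. h \<in> V - {0} \<Longrightarrow> proj_point h \<in> B \<Longrightarrow> eval_mpoly (lookup h) G = 0"
      using separating_form_subtopology[of V W B g] AB fV g(2) by metis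
    obtain m H where H: "homogeneous (Suc m) H" "eval_mpoly (lookup f) H \<noteq> 0"
      "\<And>h. h \<in> V - {0} \<Longrightarrow> eval_mpoly (lookup h) H \<noteq> 0 \<Longrightarrow> proj_point h \<in> W"
      using basic_open_neighbourhood[OF W fV(1)] f(2) by blast
    have "eval_mpoly (lookup f) (F * H) \<noteq> 0" using F(2) H(2) by (simp add: eval_mpoly_mult)
    then obtain t where t: "eval_mpoly (lookup (f + scale t (g - f))) (F * H) \<noteq> 0"
      "eval_mpoly (lookup (f + scale t (g - f))) G \<noteq> 0"
      using common_nonzero_on_line[OF inf _ G(2)] by blast
    define h where "h = f + scale t (g - f)"
    have h: "eval_mpoly (lookup h) F \<noteq> 0" "eval_mpoly (lookup h) G \<noteq> 0" "eval_mpoly (lookup h) H \<noteq> 0"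
      using t by (auto simp: h_def eval_mpoly_mult)
    have "h \<in> L"
      unfolding h_def using f g by (intro vs.subspace_add vs.subspace_scale vs.subspace_diff L) auto
    moreover have "h \<noteq> 0" using h(1) eval_at_vector_0[OF F(1)] by auto
    ultimately have hL: "h \<in> L - {0}" "h \<in> V - {0}" using L(2) by auto
    then have "proj_point h \<in> proj_space L \<inter> W" using H(3) h(3) by (auto simp: proj_space_def)
    then have "proj_point h \<in> A \<union> B" using AB by blast
    then show False using F(3) G(3) hL(2) h by blast
  qed
qed

text \<open>A flag of linear subspaces through \<open>f\<close> is obtained by choosing a coordinate \<open>a\<close> in which \<open>f\<close> is
  nonzero: the subspace for \<open>B\<close> consists of the vectors that are proportional to \<open>f\<close> in all
  coordinates outside \<open>B\<close>, and grows by one dimension with each element of \<open>A - {a}\<close>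
  added to \<open>B\<close>.\<close>

definition proportional_outside ::
  "'v set \<Rightarrow> 'v \<Rightarrow> ('v \<Rightarrow>\<^sub>0 'a::field) \<Rightarrow> 'v set \<Rightarrow> ('v \<Rightarrow>\<^sub>0 'a) set" where
  "proportional_outside A a f B =
     {v \<in> coordinate_space A. \<forall>b\<in>A - B. lookup f a * lookup v b = lookup f b * lookup v a}"

lemma subspace_proportional_outside:
  fixes f :: "'v \<Rightarrow>\<^sub>0 'a::field"
  shows "module.subspace scale (proportional_outside A a f B)"
proof -
  interpret vs: vector_space "scale :: 'a \<Rightarrow> ('v \<Rightarrow>\<^sub>0 'a) \<Rightarrow> _" by (rule vector_space_scale)
  show ?thesis
  proof (rule vs.subspaceI)
    show "0 \<in> proportional_outside A a f B"
      by (simp add: proportional_outside_def coordinate_space_def)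
    show "u + v \<in> proportional_outside A a f B"
      if "u \<in> proportional_outside A a f B" "v \<in> proportional_outside A a f B" for u v
      using that Poly_Mapping.keys_add[of u v]
      by (auto simp: proportional_outside_def coordinate_space_def lookup_add distrib_left)
    show "scale c v \<in> proportional_outside A a f B" if "v \<in> proportional_outside A a f B" for c v
      using that keys_scale_subset[of c v]
      by (auto simp: proportional_outside_def coordinate_space_def lookup_scale mult.left_commute)
  qed
qed

lemma closedin_proportional_outside:
  fixes f :: "'v \<Rightarrow>\<^sub>0 'a::field"
  assumes V: "V = coordinate_space A"
  shows "closedin (zariski V) (proj_space (proportional_outside A a f B))"
proof -
  define E :: "'v \<Rightarrow> ('v, 'a) mpoly" where "E b = Poly_Mapping.single (Poly_Mapping.single b 1) (lookup f a) -
    Poly_Mapping.single (Poly_Mapping.single a 1) (lookup f b)" for b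
  have "homogeneous 1 (E b)" for b
    unfolding E_def by (intro homogeneous_diff homogeneous_variable)
  then have hom: "\<forall>F\<in>E ` (A - B). \<exists>k. homogeneous k F" by blast
  have "proj_point v \<in> proj_space (proportional_outside A a f B) \<longleftrightarrow>
      proj_point v \<in> zero_locus V (E ` (A - B))" if "v \<in> V - {0}" for v
    using that unfolding proj_point_in_zero_locus[OF hom that]
      proj_point_in_proj_space_iff[OF subspace_proportional_outside]
    by (auto simp: proportional_outside_def V E_def eval_mpoly_diff eval_mpoly_single)
  moreover have "proj_space (proportional_outside A a f B) \<subseteq> proj_space V"
    by (auto simp: proj_space_def proportional_outside_def V)
  moreover have "zero_locus V (E ` (A - B)) \<subseteq> proj_space V" by (auto simp: zero_locus_def)
  ultimately have "proj_space (proportional_outside A a f B) = zero_locus V (E ` (A - B))"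
    unfolding proj_space_def[of V] by blast
  then show ?thesis unfolding closedin_zariski using hom by blast
qed

lemma proportional_outside_mono: "B \<subseteq> B' \<Longrightarrow> proportional_outside A a f B \<subseteq> proportional_outside A a f B'"
  by (auto simp: proportional_outside_def)

lemma krull_dim_open_ge:
  fixes V :: "('v \<Rightarrow>\<^sub>0 'a::field) set"
  assumes inf: "infinite (UNIV :: 'a set)" and A: "finite A" and V: "V = coordinate_space A"
    and W: "openin (zariski V) W" and f: "f \<in> V - {0}" "proj_point f \<in> W"
  shows "enat (card A - 1) \<le> krull_dim (subtopology (zariski V) W)"
proof -
  interpret vs: vector_space "scale :: 'a \<Rightarrow> ('v \<Rightarrow>\<^sub>0 'a) \<Rightarrow> _" by (rule vector_space_scale)
  have "keys f \<noteq> {}" using f by simp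
  then obtain a where "a \<in> keys f" by blast
  then have a: "a \<in> A" "lookup f a \<noteq> 0" using f by (auto simp: V coordinate_space_def in_keys_iff)
  have "card (A - {a}) = card A - 1" using A a by simp
  then obtain b where b: "bij_betw b {..<card A - 1} (A - {a})"
    using A by (metis bij_betw_from_nat_into_finite finite_Diff)
  define L where "L i = proportional_outside A a f (b ` {..<i})" for i
  have L: "module.subspace scale (L i)" "L i \<subseteq> V" "f \<in> L i" for i
    unfolding L_def
    by (rule subspace_proportional_outside, use f in \<open>auto simp: V proportional_outside_def mult.commute\<close>)
  have "closedin (subtopology (zariski V) W) (proj_space (L i) \<inter> W)" for i
    using closedin_proportional_outside[OF V] by (auto simp: L_def closedin_subtopology)
  moreover have "irreducible_subset (subtopology (zariski V) W) (proj_space (L i) \<inter> W)" for i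
    using f L(3)[of i] by (intro irreducible_linear_subspace[OF inf L(1,2) W]) (auto simp: proj_space_def)
  moreover have "proj_space (L i) \<inter> W \<subset> proj_space (L (Suc i)) \<inter> W" if i: "i < card A - 1" for i
  proof -
    have "proj_space (L i) \<subseteq> proj_space (L (Suc i))"
      using proportional_outside_mono[of "b ` {..<i}" "b ` {..<Suc i}" A a f]
      by (fastforce simp: proj_space_def L_def)
    moreover have "\<exists>h. proj_point h \<in> proj_space (L (Suc i)) \<inter> W - proj_space (L i)"
    proof -
      have bi: "b i \<in> A" "b i \<noteq> a" using b i by (auto simp: bij_betw_def)
      have "b i \<notin> b ` {..<i}"
        using b i unfolding bij_betw_def inj_on_def by fastforce
      \<comment> \<open>Move away from \<open>f\<close> in the direction of the new coordinate, staying inside \<open>W\<close>.\<close>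
      obtain k H where H: "homogeneous (Suc k) H" "eval_mpoly (lookup f) H \<noteq> 0"
        "\<And>h. h \<in> V - {0} \<Longrightarrow> eval_mpoly (lookup h) H \<noteq> 0 \<Longrightarrow> proj_point h \<in> W"
        using basic_open_neighbourhood[OF W f] by blast
      let ?e = "Poly_Mapping.single (b i) 1 :: 'v \<Rightarrow>\<^sub>0 'a"
      let ?l = "line_poly (lookup f) (lookup ?e) H"
      have "poly ?l 0 \<noteq> 0" using H(2) by (simp add: poly_line_poly)
      then have "?l \<noteq> 0" by auto
      then have "finite (insert 0 {t. poly ?l t = 0})" using poly_roots_finite by simp
      then obtain t where t: "t \<noteq> 0" "poly ?l t \<noteq> 0"
        using ex_new_if_finite[OF inf] by blast
      define h where "h = f + scale t ?e"
      have look: "lookup h j = lookup f j + (if j = b i then t else 0)" for j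
        by (auto simp: h_def lookup_add lookup_scale lookup_single when_def)
      have H_h: "eval_mpoly (lookup h) H \<noteq> 0" using t(2) by (simp add: poly_line_poly_vectors h_def)
      have "?e \<in> L (Suc i)"
        using bi by (auto simp: L_def proportional_outside_def coordinate_space_def lookup_single when_def)
      then have "h \<in> L (Suc i)"
        unfolding h_def by (intro vs.subspace_add vs.subspace_scale L)
      moreover have "h \<noteq> 0" using H_h eval_at_vector_0[OF H(1)] by auto
      moreover have "h \<notin> L i"
        using bi \<open>b i \<notin> b ` {..<i}\<close> t(1) a(2)
        by (auto simp: L_def proportional_outside_def look algebra_simps intro!: bexI[of _ "b i"])
      ultimately show ?thesis
        using H(3)[of h] H_h L(2)[of "Suc i"]
        by (auto simp: proj_point_in_proj_space_iff[OF L(1)] intro!: exI[of _ h])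
    qed
    ultimately show ?thesis by blast
  qed
  ultimately have "\<exists>Z. (\<forall>i\<le>card A - 1. closedin (subtopology (zariski V) W) (Z i) \<and>
      irreducible_subset (subtopology (zariski V) W) (Z i)) \<and>
      (\<forall>i<card A - 1. Z i \<subset> Z (Suc i))"
    by (intro exI[of _ "\<lambda>i. proj_space (L i) \<inter> W"]) blast
  then show ?thesis unfolding krull_dim_def by (intro Sup_upper) blast
qed

section \<open>Tangent spaces and smoothness of open subsets\<close>

lemma eval_partial:
  "eval_mpoly x (partial i F) = (\<Sum>\<mu>\<in>keys F.
     of_nat (lookup \<mu> i) * lookup F \<mu> * eval_monomial x (\<mu> - Poly_Mapping.single i 1))"
  by (simp add: partial_def eval_mpoly_sum eval_mpoly_single)

lemma derivative_monomial_along_line: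
  fixes x y :: "'v \<Rightarrow> 'a::field"
  assumes "finite A" "keys \<mu> \<subseteq> A"
  shows "poly (pderiv (eval_monomial (\<lambda>i. [:x i, y i:]) \<mu>)) 0 =
    (\<Sum>i\<in>A. of_nat (lookup \<mu> i) * eval_monomial x (\<mu> - Poly_Mapping.single i 1) * y i)"
proof -
  have "poly ((\<Prod>j\<in>A - {i}. [:x j, y j:] ^ lookup \<mu> j) * pderiv ([:x i, y i:] ^ lookup \<mu> i)) 0 =
      of_nat (lookup \<mu> i) * eval_monomial x (\<mu> - Poly_Mapping.single i 1) * y i" if "i \<in> A" for i
  proof -
    let ?\<nu> = "\<mu> - Poly_Mapping.single i 1"
    have "keys ?\<nu> \<subseteq> A" using assms(2) by (auto simp: in_keys_iff lookup_minus)
    then have "eval_monomial x ?\<nu> = x i ^ lookup ?\<nu> i * (\<Prod>j\<in>A - {i}. x j ^ lookup ?\<nu> j)"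
      using assms(1) that by (simp add: eval_monomial_superset[of A] prod.remove)
    also have "(\<Prod>j\<in>A - {i}. x j ^ lookup ?\<nu> j) = (\<Prod>j\<in>A - {i}. x j ^ lookup \<mu> j)"
      by (intro prod.cong) (auto simp: lookup_minus lookup_single when_def)
    finally have "eval_monomial x ?\<nu> = x i ^ (lookup \<mu> i - 1) * (\<Prod>j\<in>A - {i}. x j ^ lookup \<mu> j)"
      by (simp add: lookup_minus)
    then show ?thesis by (simp add: poly_prod pderiv_power pderiv_pCons mult_ac)
  qed
  then show ?thesis
    using assms by (simp add: eval_monomial_superset[of A] pderiv_prod poly_sum)
qed

lemma pderiv_sum:
  fixes p :: "'i \<Rightarrow> 'a::{comm_semiring_1, semiring_no_zero_divisors} poly"
  shows "pderiv (\<Sum>i\<in>I. p i) = (\<Sum>i\<in>I. pderiv (p i))"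
  by (induction I rule: infinite_finite_induct) (auto simp: pderiv_add)

lemma derivative_along_line:
  fixes f v :: "'v \<Rightarrow>\<^sub>0 'a::field"
  shows "poly (pderiv (line_poly (lookup f) (lookup v) F)) 0 =
    (\<Sum>i\<in>keys v. eval_mpoly (lookup f) (partial i F) * lookup v i)"
proof -
  let ?t = "\<lambda>\<mu> i. of_nat (lookup \<mu> i) * lookup F \<mu> *
    eval_monomial (lookup f) (\<mu> - Poly_Mapping.single i 1) * lookup v i"
  have "lookup F \<mu> * poly (pderiv (eval_monomial (\<lambda>i. [:lookup f i, lookup v i:]) \<mu>)) 0 =
      (\<Sum>i\<in>keys v. ?t \<mu> i)" for \<mu>
  proof -
    have "lookup F \<mu> * poly (pderiv (eval_monomial (\<lambda>i. [:lookup f i, lookup v i:]) \<mu>)) 0 =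
        (\<Sum>i\<in>keys \<mu> \<union> keys v. ?t \<mu> i)"
      by (subst derivative_monomial_along_line[of "keys \<mu> \<union> keys v"])
        (auto simp: sum_distrib_left mult_ac)
    also have "\<dots> = (\<Sum>i\<in>keys v. ?t \<mu> i)"
      by (intro sum.mono_neutral_right) (auto simp: in_keys_iff)
    finally show ?thesis .
  qed
  then have "poly (pderiv (line_poly (lookup f) (lookup v) F)) 0 = (\<Sum>\<mu>\<in>keys F. \<Sum>i\<in>keys v. ?t \<mu> i)"
    by (simp add: line_poly_def pderiv_sum pderiv_smult poly_sum)
  also have "\<dots> = (\<Sum>i\<in>keys v. \<Sum>\<mu>\<in>keys F. ?t \<mu> i)" by (rule sum.swap)
  finally show ?thesis by (simp add: eval_partial sum_distrib_right)
qed

text \<open>A form that vanishes on an open set containing \<open>f\<close> vanishes at all but finitely many points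
  of each line through \<open>f\<close>, hence on the whole line, so its derivative in the direction of the
  line is zero at \<open>f\<close>.\<close>

lemma proj_tangent_space_open:
  fixes V :: "('v \<Rightarrow>\<^sub>0 'a::field) set"
  assumes inf: "infinite (UNIV :: 'a set)" and V: "module.subspace scale V"
    and X: "openin (zariski V) X" and f: "f \<in> V - {0}" "proj_point f \<in> X"
  shows "proj_tangent_space V X f = V"
proof -
  interpret vs: vector_space "scale :: 'a \<Rightarrow> ('v \<Rightarrow>\<^sub>0 'a) \<Rightarrow> _" by (rule vector_space_scale)
  obtain k H where H: "homogeneous (Suc k) H" "eval_mpoly (lookup f) H \<noteq> 0"
    "\<And>g. g \<in> V - {0} \<Longrightarrow> eval_mpoly (lookup g) H \<noteq> 0 \<Longrightarrow> proj_point g \<in> X"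
    using basic_open_neighbourhood[OF X f] by blast
  have "(\<Sum>i\<in>keys v. eval_mpoly (lookup f) (partial i F) * lookup v i) = 0"
    if v: "v \<in> V" and F: "homogeneous l F" "\<forall>p\<in>X. vanishes_at F p" for v F l
  proof -
    let ?l = "line_poly (lookup f) (lookup v)"
    have "poly (?l F * ?l H) t = 0" for t
    proof (cases "poly (?l H) t = 0")
      case False
      let ?g = "f + scale t v"
      have g: "eval_mpoly (lookup ?g) H \<noteq> 0" using False by (simp add: poly_line_poly_vectors)
      moreover have "?g \<in> V" using f v by (intro vs.subspace_add vs.subspace_scale V) auto
      moreover have "?g \<noteq> 0" using g eval_at_vector_0[OF H(1)] by auto
      ultimately have "proj_point ?g \<in> X" using H(3) by blast
      then have "eval_mpoly (lookup ?g) F = 0" using F vanishes_at_proj_point by blast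
      then show ?thesis by (simp add: poly_line_poly_vectors)
    qed simp
    then have "?l F * ?l H = 0" using poly_roots_finite[of "?l F * ?l H"] inf by auto
    moreover have "poly (?l H) 0 \<noteq> 0" using H(2) by (simp add: poly_line_poly)
    ultimately have "?l F = 0" by auto
    then show ?thesis using derivative_along_line[of f v F] by simp
  qed
  then show ?thesis unfolding proj_tangent_space_def by blast
qed

text \<open>The Krull dimension is the same for all nonempty open subsets, so the infimum that
  defines the local dimension is taken over a single value.\<close>

theorem smooth_subset_open:
  fixes X :: "('v \<Rightarrow>\<^sub>0 'a::field) set set"
  assumes inf: "infinite (UNIV :: 'a set)" and A: "finite A"
    and X: "openin (zariski (coordinate_space A)) X"
  shows "smooth_subset (coordinate_space A) X"
  unfolding smooth_subset_def
proof (intro conjI ballI impI)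
  let ?V = "coordinate_space A :: ('v \<Rightarrow>\<^sub>0 'a) set"
  have "X \<subseteq> proj_space ?V" using openin_subset[OF X] by simp
  then have "X = X \<inter> proj_space ?V" by blast
  then show "\<exists>U C. openin (zariski ?V) U \<and> closedin (zariski ?V) C \<and> X = U \<inter> C"
    using X by (metis closedin_topspace topspace_zariski)
next
  interpret vs: vector_space "scale :: 'a \<Rightarrow> ('v \<Rightarrow>\<^sub>0 'a) \<Rightarrow> _" by (rule vector_space_scale)
  let ?V = "coordinate_space A :: ('v \<Rightarrow>\<^sub>0 'a) set"
  have sub: "vs.subspace ?V"
    using subspace_proportional_outside[of A _ _ A] by (simp add: proportional_outside_def)
  fix f assume f: "f \<in> ?V - {0}" "proj_point f \<in> X"
  have "A \<noteq> {}" using f by (auto simp: coordinate_space_def)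
  then have card_A: "card A > 0" using A by (simp add: card_gt_0_iff)
  have "krull_dim (subtopology (subtopology (zariski ?V) X) U) = enat (card A - 1)"
    if "openin (subtopology (zariski ?V) X) U" "proj_point f \<in> U" for U
  proof -
    have U: "openin (zariski ?V) (X \<inter> U)"
      using that(1) X by (simp add: openin_open_subtopology openin_Int)
    have "subtopology (subtopology (zariski ?V) X) U = subtopology (zariski ?V) (X \<inter> U)"
      by (rule subtopology_subtopology)
    then show ?thesis
      using krull_dim_subtopology_le[OF A refl] krull_dim_open_ge[OF inf A refl U f(1)] f(2) that(2)
      by (auto intro: antisym)
  qed
  moreover have "openin (subtopology (zariski ?V) X) X"
    using X by (simp add: openin_open_subtopology)
  ultimately have "{krull_dim (subtopology (subtopology (zariski ?V) X) U) |U.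
      openin (subtopology (zariski ?V) X) U \<and> proj_point f \<in> U} = {enat (card A - 1)}"
    using f(2) by force
  then have "local_dim (subtopology (zariski ?V) X) (proj_point f) = enat (card A - 1)"
    by (simp add: local_dim_def)
  moreover have "vs.dim (proj_tangent_space ?V X f) = card A"
    using proj_tangent_space_open[OF inf sub X f] dim_supported_in[OF A]
    by (simp add: coordinate_space_def)
  ultimately show "smooth_at ?V X f"
    using card_A by (simp add: smooth_at_def one_enat_def)
qed

section \<open>The standard locus is open\<close>

text \<open>Linear independence of \<open>m\<close> vectors of forms is witnessed by a form, such as a maximal minor
  of the matrix they make up. Here one is obtained by fraction-free Gaussian elimination: a nonzero
  entry \<open>p\<close> of the last vector is used to cancel the corresponding entry of the others, and \<open>p\<close> times
  the form witnessing independence of the remaining vectors is the form sought.\<close>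

lemma independence_witness:
  fixes v :: "nat \<Rightarrow> 'n \<Rightarrow> ('v, 'a::field) mpoly"
  assumes "\<And>i \<nu>. i < m \<Longrightarrow> homogeneous e (v i \<nu>)"
    and "\<And>l. \<forall>\<nu>. (\<Sum>i<m. l i * eval_mpoly x (v i \<nu>)) = 0 \<Longrightarrow> \<forall>i<m. l i = 0"
  shows "\<exists>k D. homogeneous k D \<and> eval_mpoly x D \<noteq> 0 \<and> (\<forall>y l. eval_mpoly y D \<noteq> 0 \<longrightarrow>
    (\<forall>\<nu>. (\<Sum>i<m. l i * eval_mpoly y (v i \<nu>)) = 0) \<longrightarrow> (\<forall>i<m. l i = 0))"
  using assms
proof (induction m arbitrary: e v)
  case 0
  have "homogeneous 0 (1 :: ('v, 'a) mpoly)" by (simp add: homogeneous_def total_degree_def)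
  then show ?case by (intro exI[of _ 0] exI[of _ 1]) simp
next
  case (Suc m)
  note hom = Suc.prems(1) and indep = Suc.prems(2)
  have "\<exists>\<nu>. eval_mpoly x (v m \<nu>) \<noteq> 0"
  proof (rule ccontr)
    assume "\<not> ?thesis"
    then have "\<forall>\<nu>. (\<Sum>i<Suc m. (if i = m then 1 else 0) * eval_mpoly x (v i \<nu>)) = 0" by simp
    from indep[OF this] show False by auto
  qed
  \<comment> \<open>The pivot entry of the last vector, and the vectors left after eliminating its position from
    the others.\<close>
  then obtain \<nu>0 where \<nu>0: "eval_mpoly x (v m \<nu>0) \<noteq> 0" by blast
  define p where "p = v m \<nu>0"
  define w where "w i \<nu> = p * v i \<nu> - v i \<nu>0 * v m \<nu>" for i \<nu>
  have combination: "(\<Sum>i<m. l i * eval_mpoly y (w i \<nu>)) =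
      eval_mpoly y p * (\<Sum>i<m. l i * eval_mpoly y (v i \<nu>)) -
      (\<Sum>i<m. l i * eval_mpoly y (v i \<nu>0)) * eval_mpoly y (v m \<nu>)" for l y \<nu>
    by (simp add: w_def eval_mpoly_diff eval_mpoly_mult right_diff_distrib sum_subtractf
        sum_distrib_left sum_distrib_right mult_ac)
  have "\<exists>k D. homogeneous k D \<and> eval_mpoly x D \<noteq> 0 \<and> (\<forall>y l. eval_mpoly y D \<noteq> 0 \<longrightarrow>
    (\<forall>\<nu>. (\<Sum>i<m. l i * eval_mpoly y (w i \<nu>)) = 0) \<longrightarrow> (\<forall>i<m. l i = 0))"
  proof (rule Suc.IH)
    show "homogeneous (e + e) (w i \<nu>)" if "i < m" for i \<nu>
      unfolding w_def p_def using that by (intro homogeneous_diff homogeneous_mult hom) auto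
    fix l assume l: "\<forall>\<nu>. (\<Sum>i<m. l i * eval_mpoly x (w i \<nu>)) = 0"
    \<comment> \<open>A relation between the \<open>w i\<close> is one between the \<open>v i\<close>, with these coefficients.\<close>
    define l' where "l' i = (if i = m then - (\<Sum>i<m. l i * eval_mpoly x (v i \<nu>0))
      else l i * eval_mpoly x p)" for i
    have "(\<Sum>i<Suc m. l' i * eval_mpoly x (v i \<nu>)) = (\<Sum>i<m. l i * eval_mpoly x (w i \<nu>))" for \<nu>
      unfolding combination by (simp add: l'_def sum_distrib_left mult_ac)
    then have "\<forall>i<Suc m. l' i = 0" using l by (intro indep) simp
    then have "l i * eval_mpoly x p = 0" if "i < m" for i
      using that by (metis l'_def less_SucI less_irrefl)
    then show "\<forall>i<m. l i = 0" using \<nu>0 by (simp add: p_def)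
  qed
  then obtain k D where D: "homogeneous k D" "eval_mpoly x D \<noteq> 0"
    "\<And>y l. eval_mpoly y D \<noteq> 0 \<Longrightarrow>
      \<forall>\<nu>. (\<Sum>i<m. l i * eval_mpoly y (w i \<nu>)) = 0 \<Longrightarrow> \<forall>i<m. l i = 0"
    by blast
  have "\<forall>i<Suc m. l i = 0" if y: "eval_mpoly y (D * p) \<noteq> 0"
    and l: "\<forall>\<nu>. (\<Sum>i<Suc m. l i * eval_mpoly y (v i \<nu>)) = 0" for y l
  proof -
    have "(\<Sum>i<m. l i * eval_mpoly y (v i \<nu>)) = - (l m * eval_mpoly y (v m \<nu>))" for \<nu>
      using l by (simp add: eq_neg_iff_add_eq_0)
    then have "\<forall>\<nu>. (\<Sum>i<m. l i * eval_mpoly y (w i \<nu>)) = 0"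
      unfolding combination by (simp add: p_def)
    moreover have "eval_mpoly y D \<noteq> 0" using y by (simp add: eval_mpoly_mult)
    ultimately have l_0: "\<forall>i<m. l i = 0" using D(3) by blast
    then have "l m * eval_mpoly y p = 0" using l[rule_format, of \<nu>0] by (simp add: p_def)
    then show ?thesis using l_0 y by (auto simp: eval_mpoly_mult less_Suc_eq)
  qed
  moreover have "homogeneous (k + e) (D * p)"
    using D(1) hom by (auto simp: p_def intro: homogeneous_mult)
  moreover have "eval_mpoly x (D * p) \<noteq> 0" using D(2) \<nu>0 by (simp add: eval_mpoly_mult p_def)
  ultimately show ?case by blast
qed

lemma graded_part_eq_coordinate_space: "graded_part m d = coordinate_space (monomials {..<m} d)"
  by (auto simp: graded_part_def coordinate_space_def homogeneous_def monomials_def)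

lemma monomials_degree_1: "monomials A 1 = (\<lambda>i. Poly_Mapping.single i 1) ` A"
proof (intro equalityI subsetI)
  fix \<mu> assume assms: "\<mu> \<in> monomials A 1"
  have "keys \<mu> \<noteq> {}" using assms by (auto simp: monomials_def total_degree_def)
  then obtain i where i: "i \<in> keys \<mu>" by blast
  let ?\<nu> = "\<mu> - Poly_Mapping.single i 1"
  have "total_degree \<mu> = total_degree ?\<nu> + 1"
    using diff_single_add[OF i] total_degree_add[of ?\<nu> "Poly_Mapping.single i 1"]
    by (simp add: total_degree_def)
  then have "?\<nu> \<in> monomials UNIV 0" using assms by (simp add: monomials_def)
  then have "\<mu> = Poly_Mapping.single i 1"
    using diff_single_add[OF i] by (simp add: monomials_degree_0)
  then show "\<mu> \<in> (\<lambda>i. Poly_Mapping.single i 1) ` A" using i assms by (auto simp: monomials_def)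
qed (use single_in_monomials in auto)

lemma lookup_partial:
  "lookup (partial i F) \<nu> = of_nat (lookup \<nu> i + 1) * lookup F (\<nu> + Poly_Mapping.single i 1)"
proof -
  let ?\<mu> = "\<nu> + Poly_Mapping.single i 1"
  have "lookup (partial i F) \<nu> = (\<Sum>\<mu>\<in>keys F. if \<mu> - Poly_Mapping.single i 1 = \<nu>
      then of_nat (lookup \<mu> i) * lookup F \<mu> else 0)"
    by (simp add: partial_def lookup_sum lookup_single when_def)
  also have "\<dots> = (\<Sum>\<mu>\<in>keys F. if \<mu> = ?\<mu> then of_nat (lookup \<mu> i) * lookup F \<mu> else 0)"
  proof (rule sum.cong)
    fix \<mu>
    have "\<mu> - Poly_Mapping.single i 1 = \<nu> \<longleftrightarrow> \<mu> = ?\<mu>" if "lookup \<mu> i \<noteq> 0"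
      using diff_single_add[of i \<mu>] that by (metis add_diff_cancel_right' in_keys_iff)
    then show "(if \<mu> - Poly_Mapping.single i 1 = \<nu> then of_nat (lookup \<mu> i) * lookup F \<mu> else 0) =
        (if \<mu> = ?\<mu> then of_nat (lookup \<mu> i) * lookup F \<mu> else 0)"
      by (cases "lookup \<mu> i = 0") simp_all
  qed simp
  also have "\<dots> = of_nat (lookup \<nu> i + 1) * lookup F ?\<mu>"
    by (auto simp: in_keys_iff lookup_add)
  finally show ?thesis .
qed

lemma diff_action_linear:
  fixes f :: "(nat, 'a::field) mpoly"
  assumes "q \<in> graded_part m 1"
  shows "diff_action q f = (\<Sum>i<m. scale (lookup q (Poly_Mapping.single i 1)) (partial i f))"
proof -
  let ?X = "\<lambda>i :: nat. Poly_Mapping.single i (1 :: nat)"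
  have inj: "inj_on ?X {..<m}"
    by (rule inj_onI) (metis keys_single one_neq_zero singleton_inject)
  have "keys q \<subseteq> ?X ` {..<m}"
    using assms unfolding graded_part_eq_coordinate_space coordinate_space_def monomials_degree_1
    by simp
  then have "diff_action q f =
      (\<Sum>\<mu>\<in>?X ` {..<m}. scale (lookup q \<mu>) (partial_monomial \<mu> f))"
    unfolding diff_action_def
    by (intro sum.mono_neutral_left) (auto simp: in_keys_iff intro!: poly_mapping_eqI simp: lookup_scale)
  also have "\<dots> = (\<Sum>i<m. scale (lookup q (?X i)) (partial i f))"
    using inj by (simp add: sum.reindex partial_monomial_def)
  finally show ?thesis .
qed

lemma standard_iff_partials_independent:
  fixes f :: "(nat, 'a::field) mpoly"
  shows "(\<forall>q\<in>graded_part m 1 - {0}. diff_action q f \<noteq> 0) \<longleftrightarrow>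
    (\<forall>l. (\<forall>\<nu>. (\<Sum>i<m. l i * lookup (partial i f) \<nu>) = 0) \<longrightarrow> (\<forall>i<m. l i = 0))"
    (is "?standard \<longleftrightarrow> ?independent")
proof
  assume ?standard
  show ?independent
  proof (intro allI impI)
    fix l :: "nat \<Rightarrow> 'a" and i
    assume l: "\<forall>\<nu>. (\<Sum>i<m. l i * lookup (partial i f) \<nu>) = 0" and i: "i < m"
    define q where "q = (\<Sum>j<m. Poly_Mapping.single (Poly_Mapping.single j (1 :: nat)) (l j))"
    have "keys q \<subseteq> monomials {..<m} 1"
      unfolding q_def by (intro keys_sum_monomials) (auto intro: single_in_monomials)
    then have q: "q \<in> graded_part m 1"
      by (simp add: graded_part_eq_coordinate_space coordinate_space_def)
    have look: "lookup q (Poly_Mapping.single j 1) = l j" if "j < m" for j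
    proof -
      have "(Poly_Mapping.single k (1 :: nat) = Poly_Mapping.single j 1) = (k = j)" for k
        by (metis keys_single one_neq_zero singleton_inject)
      then show ?thesis using that by (simp add: q_def lookup_sum lookup_single when_def)
    qed
    have "diff_action q f = 0"
      unfolding diff_action_linear[OF q]
      using l by (intro poly_mapping_eqI) (simp add: lookup_sum lookup_scale look[simplified])
    then have "q = 0" using \<open>?standard\<close> q by blast
    then show "l i = 0" using look[OF i] by simp
  qed
next
  assume ?independent
  show ?standard
  proof (intro ballI notI)
    fix q :: "(nat, 'a) mpoly" assume q: "q \<in> graded_part m 1 - {0}" and "diff_action q f = 0"
    then have "lookup (\<Sum>i<m. scale (lookup q (Poly_Mapping.single i 1)) (partial i f)) \<nu> = 0" for \<nu>
      using diff_action_linear[of q m f] by simp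
    then have "\<forall>\<nu>. (\<Sum>i<m. lookup q (Poly_Mapping.single i 1) * lookup (partial i f) \<nu>) = 0"
      by (simp add: lookup_sum lookup_scale)
    then have "\<forall>i<m. lookup q (Poly_Mapping.single i 1) = 0"
      by (rule \<open>?independent\<close>[THEN spec, THEN mp])
    moreover have "keys q \<subseteq> (\<lambda>i. Poly_Mapping.single i 1) ` {..<m}" "keys q \<noteq> {}"
      using q unfolding graded_part_eq_coordinate_space coordinate_space_def monomials_degree_1
      by auto
    moreover from this obtain i where "i < m" "Poly_Mapping.single i 1 \<in> keys q" by blast
    ultimately show False by (simp add: in_keys_iff)
  qed
qed

text \<open>The coefficients of the partial derivatives of \<open>f\<close> are linear forms in the coefficients
  of \<open>f\<close>.\<close>

lemma openin_standard_locus: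
  "openin (zariski (graded_part m d)) (standard_locus m d :: (nat, 'a::field) mpoly set set)"
proof (subst openin_subopen, rule ballI)
  let ?V = "graded_part m d :: (nat, 'a) mpoly set"
  fix p :: "(nat, 'a) mpoly set" assume "p \<in> standard_locus m d"
  then obtain f where f: "p = proj_point f" "f \<in> ?V - {0}"
    and standard: "\<forall>q\<in>graded_part m 1 - {0}. diff_action q f \<noteq> 0"
    by (auto simp: standard_locus_def)
  define v :: "nat \<Rightarrow> (nat \<Rightarrow>\<^sub>0 nat) \<Rightarrow> (nat \<Rightarrow>\<^sub>0 nat, 'a) mpoly" where
    "v i \<nu> = Poly_Mapping.single (Poly_Mapping.single (\<nu> + Poly_Mapping.single i 1) 1)
      (of_nat (lookup \<nu> i + 1))" for i \<nu>
  have eval_v: "eval_mpoly (lookup g) (v i \<nu>) = lookup (partial i g) \<nu>" for g i \<nu>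
    by (simp add: v_def eval_mpoly_single lookup_partial)
  have hom: "homogeneous 1 (v i \<nu>)" for i \<nu> unfolding v_def by (rule homogeneous_variable)
  obtain k D where D: "homogeneous k D" "eval_mpoly (lookup f) D \<noteq> 0"
    "\<And>g l. eval_mpoly (lookup g) D \<noteq> 0 \<Longrightarrow>
      \<forall>\<nu>. (\<Sum>i<m. l i * lookup (partial i g) \<nu>) = 0 \<Longrightarrow> \<forall>i<m. l i = 0"
    using independence_witness[of m 1 v "lookup f", OF hom] standard
    unfolding standard_iff_partials_independent eval_v[symmetric] by blast
  let ?U = "proj_space ?V - zero_locus ?V {D}"
  have "\<forall>F\<in>{D}. \<exists>k. homogeneous k F" using D(1) by blast
  note in_locus = proj_point_in_zero_locus[OF this]
  have "openin (zariski ?V) ?U" unfolding openin_zariski using D(1) by blast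
  moreover have "p \<in> ?U" using f D(2) in_locus[OF f(2)] by (auto simp: proj_space_def)
  moreover have "?U \<subseteq> standard_locus m d"
  proof
    fix p' assume p': "p' \<in> ?U"
    then obtain g where g: "g \<in> ?V - {0}" "p' = proj_point g" by (auto simp: proj_space_def)
    then have "eval_mpoly (lookup g) D \<noteq> 0" using p' in_locus[OF g(1)] by simp
    then have "\<forall>q\<in>graded_part m 1 - {0}. diff_action q g \<noteq> 0"
      unfolding standard_iff_partials_independent using D(3) by blast
    then show "p' \<in> standard_locus m d" using g by (auto simp: standard_locus_def)
  qed
  ultimately show "\<exists>U. openin (zariski ?V) U \<and> p \<in> U \<and> U \<subseteq> standard_locus m d" by blast
qed

theorem corollary2p8:
  fixes m d :: nat
  assumes "m \<ge> 2" and "d \<ge> 1"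
  shows "smooth_subset (graded_part m d)
           (standard_locus m d :: (nat, 'a::{alg_closed_field, field_char_0}) mpoly set set)"
proof -
  have "finite (monomials {..<m} d)"
    using assms(1) by (intro finite_card_monomials_le(1)[of _ 0]) auto
  then show ?thesis
    unfolding graded_part_eq_coordinate_space
    using openin_standard_locus[of m d, unfolded graded_part_eq_coordinate_space]
    by (intro smooth_subset_open infinite_UNIV_char_0)
qed

end
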